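(* Let $T$ be a circle map $T(x)=x(1+V(x)) \bmod 1$ as described in the context. Let $\omega$ and $\Omega$ be moduli of continuity such that $\Omega$ is $T$-compatible with respect to $\omega$, with constants $\varrho_1$ and $C_1$, where $\varrho_1<\varrho_V$. Suppose that $\Omega$ is concave. Let $f\in\mathscr C_\omega(\mathbb T)$, with associated eigenvalue $\chi$, eigenfunction $h$ and normalized potential $\tilde f=f+\log h-\log h\circ T-\log\chi$. Put $\kappa_f:=C_1^{-1}|f|_\omega$, $\Gamma:=\max\{2\kappa_fe^{2\kappa_f\Omega(1/2)},\lceil\max h/\min h\rceil\}$ and $$\theta(n):=\frac1{\chi^n}\big\|\mathscr L_{f-\log(1+V)}^n\mathds 1\big\|_\infty .$$ Then for every $n\ge1$, every $\phi\in\mathscr C_\Omega(\mathbb T)$ and all $x,y\in\mathbb T$ with $d(x,y)<\varrho_1$, $$\big|\mathscr L_{\tilde f}^n\phi(x)-\mathscr L_{\tilde f}^n\phi(y)\big|\le\Gamma\Big(|\phi|_\Omega\,\Omega\big(\theta(n)\,d(x,y)\big)+\|\phi\|_\infty\,\Omega(d(x,y))\Big).$$ In particular, there exists a positive multiple $\tilde\Gamma=\tilde\Gamma(\varrho_1)$ of the constant $\Gamma$ such that, for all $n\ge1$ and all $\phi\in\mathscr C_\Omega(\mathbb T)$, $$\big|\mathscr L_{\tilde f}^n\phi\big|_\Omega\le\tilde\Gamma\big(\tau(n)\,|\phi|_\Omega+\|\phi\|_\infty\big),\qquad\text{with}\quad \tau(n):=\sup_{0<\mathsf d<1/2}\frac{\Omega(\theta(n)\,\mathsf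 d)}{\Omega(\mathsf d)}.$$
   Context: Phase space and dynamics: $\mathbb T=[0,1)$ is the circle with metric $d(x,y)=\min\{|x-y|,|x-y\pm1|\}$. $T:\mathbb T\to\mathbb T$ is the continuous map $T(x)=x(1+V(x)) \bmod 1$, where $V:[0,\infty)\to[0,\infty)$ is continuous and increasing, $V(1)$ is a positive integer, and $V$ is regularly varying at $0$: there is $\sigma\ge0$ with $\lim_{x\to0}V(tx)/V(x)=t^\sigma$ for all $t>0$. $N_V:=1+V(1)$ is the number of inverse branches of $T$. The constant $\varrho_V\in(0,1/2)$ is fixed so that: (i) if $x,y\in[0,1]$ and $|x-y|<\varrho_V$ then $|x-y|N_V+|V(x)-V(y)|<1/2$; (ii) $\varrho_V<\frac12\min_{0\le i<N_V}d(a_{i+1},a_i)$, where $\{a_i\}_{i=0}^{N_V-1}$ is the positively oriented set of pre-images under $T$ of $a_0:=0=:a_{N_V}$; (iii) $\varrho_V+\varrho_VV(\varrho_V)+V(1)-(1-\varrho_V)V(1-\varrho_V)<1/2$. Moduli of continuity: a modulus of continuity is a continuous non-decreasing function $\omega:[0,\infty)\to[0,\infty)$ with $\omega(0)=0$ (and $\omega(t)>0$ for $t>0$, so that the quotients make sense). $|f|_\omega:=\sup_{x\ne y}|f(x)-f(y)|/\omega(d(x,y))$, and $\mathscr C_\omega(\mathbb T)$ is the space of real-valued continuous functions $f$ on $\mathbb T$ with $|f|_\omega<\infty$. $T$-compatibility: a pre-orbit of $x_0$ is a sequence $\{x_k\}_{k\ge0}$ with $T(x_{k+1})=x_k$ for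 all $k$. $\Omega$ is $T$-compatible with respect to $\omega$, with constants $\varrho_1,C_1>0$, if for any $x_0,y_0$ with $d(x_0,y_0)<\varrho_1$ there is a bijection between the pre-orbits $\{x_k\}$ of $x_0$ and the pre-orbits $\{y_k\}$ of $y_0$ such that corresponding pre-orbits satisfy, for all $k$, $d(x_k,y_k)\le d(x_0,y_0)<\varrho_1$ and $C_1\sum_{j=1}^k\omega(d(x_j,y_j))\le\Omega(d(x_0,y_0))-\Omega(d(x_k,y_k))$. Transfer operator: for a real function $g$ on $\mathbb T$, $\mathscr L_g\phi(x)=\sum_{y\in T^{-1}(x)}e^{g(y)}\phi(y)$; $\mathds 1$ is the constant function $1$; $V$ is evaluated at points of $\mathbb T=[0,1)$. Known fact (Ruelle-Perron-Frobenius theorem from earlier work): if $\Omega$ is $T$-compatible with respect to $\omega$ and $f\in\mathscr C_\omega(\mathbb T)$, there are $\chi>0$ (the maximal eigenvalue), a strictly positive $h\in\mathscr C_\Omega(\mathbb T)$ and a Borel probability measure $\nu$ with $\mathscr L_fh=\chi h$, $\mathscr L_f^*\nu=\chi\nu$, $\int h\,d\nu=1$, and $\chi^{-n}\mathscr L_f^n\psi\to h\int\psi\,d\nu$ uniformly for every continuous $\psi$; moreover $h(x)\le h(y)e^{\kappa_f\Omega(d(x,y))}$ whenever $d(x,y)<\varrho_1$, where $\kappa_f=C_1^{-1}|f|_\omega$. *)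

theory Defs
  imports "HOL-Probability.Probability_Measure"
begin

section \<open>The circle\<close>

typedef circle = "{0..<1::real}"
  morphisms coord Abs_circle
  by (rule exI[of _ 0]) simp

definition circle_of :: "real \<Rightarrow> circle" where
  "circle_of r = Abs_circle (frac r)"

lemma coord_bounds: "0 \<le> coord x" "coord x < 1"
  using coord[of x] by auto

lemma coord_circle_of: "coord (circle_of r) = frac r"
  unfolding circle_of_def by (rule Abs_circle_inverse) (simp add: frac_lt_1)

instantiation circle :: metric_space
begin

definition dist_circle :: "circle \<Rightarrow> circle \<Rightarrow> real" where
  "dist x y = Min {\<bar>coord x - coord y\<bar>, \<bar>coord x - coord y + 1\<bar>, \<bar>coord x - coord y - 1\<bar>}"

definition uniformity_circle :: "(circle \<times> circle) filter" where
  "uniformity_circle = (INF e\<in>{0<..}. principal {(x, y). dist x y < e})"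

definition open_circle :: "circle set \<Rightarrow> bool" where
  "open_circle U \<longleftrightarrow> (\<forall>x\<in>U. eventually (\<lambda>(x', y). x' = x \<longrightarrow> y \<in> U) uniformity)"

instance
proof
  fix x y z :: circle
  show "(dist x y = 0) = (x = y)"
    using coord_bounds[of x] coord_bounds[of y]
    by (auto simp: dist_circle_def coord_inject min_def)
  show "dist x y \<le> dist x z + dist y z"
    using coord_bounds[of x] coord_bounds[of y] coord_bounds[of z]
    unfolding dist_circle_def by (simp add: min_def abs_if)
qed (simp_all add: uniformity_circle_def open_circle_def)

end

section \<open>The map\<close>

text \<open>
  \<open>V\<close> is only ever evaluated on \<open>[0,\<infinity>)\<close>. Since \<open>V\<close> is monotone in the weak sense here, strictly
  increasing functions are a special case.
\<close>

definition regularly_varying_at_0 :: "(real \<Rightarrow> real) \<Rightarrow> bool" where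
  "regularly_varying_at_0 V \<longleftrightarrow>
     (\<exists>\<sigma>\<ge>0. \<forall>t>0. ((\<lambda>x. V (t * x) / V x) \<longlongrightarrow> t powr \<sigma>) (at_right 0))"

definition admissible_V :: "(real \<Rightarrow> real) \<Rightarrow> bool" where
  "admissible_V V \<longleftrightarrow>
     continuous_on {0..} V \<and> mono_on {0..} V \<and> (\<forall>x\<ge>0. 0 \<le> V x) \<and>
     (\<exists>m::nat. 0 < m \<and> V 1 = real m) \<and> regularly_varying_at_0 V"

definition circle_map :: "(real \<Rightarrow> real) \<Rightarrow> circle \<Rightarrow> circle" where
  "circle_map V x = circle_of (coord x * (1 + V (coord x)))"

definition num_branches :: "(real \<Rightarrow> real) \<Rightarrow> nat" where
  "num_branches V = 1 + nat \<lfloor>V 1\<rfloor>"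

text \<open>
  \<open>a 0, \<dots>, a (N - 1)\<close> enumerates the preimages of \<open>0\<close> in positive (counterclockwise) order
  starting from the fixed point \<open>0\<close>, and \<open>a N\<close> closes the cycle.
\<close>

definition oriented_zero_preimages :: "(real \<Rightarrow> real) \<Rightarrow> (nat \<Rightarrow> circle) \<Rightarrow> bool" where
  "oriented_zero_preimages V a \<longleftrightarrow>
     a 0 = circle_of 0 \<and> a (num_branches V) = circle_of 0 \<and>
     a ` {..<num_branches V} = circle_map V -` {circle_of 0} \<and>
     strict_mono_on {..<num_branches V} (\<lambda>i. coord (a i))"

definition admissible_radius :: "(real \<Rightarrow> real) \<Rightarrow> real \<Rightarrow> bool" where
  "admissible_radius V \<rho> \<longleftrightarrow>
     0 < \<rho> \<and> \<rho> < 1/2 \<and>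
     (\<forall>x\<in>{0..1}. \<forall>y\<in>{0..1}. \<bar>x - y\<bar> < \<rho> \<longrightarrow>
        \<bar>x - y\<bar> * real (num_branches V) + \<bar>V x - V y\<bar> < 1/2) \<and>
     (\<exists>a. oriented_zero_preimages V a \<and>
        \<rho> < 1/2 * Min ((\<lambda>i. dist (a (Suc i)) (a i)) ` {..<num_branches V})) \<and>
     \<rho> + \<rho> * V \<rho> + V 1 - (1 - \<rho>) * V (1 - \<rho>) < 1/2"

section \<open>Moduli of continuity\<close>

definition modulus_of_continuity :: "(real \<Rightarrow> real) \<Rightarrow> bool" where
  "modulus_of_continuity \<omega> \<longleftrightarrow>
     continuous_on {0..} \<omega> \<and> mono_on {0..} \<omega> \<and> \<omega> 0 = 0 \<and> (\<forall>t>0. 0 < \<omega> t)"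

definition mod_quotients :: "(real \<Rightarrow> real) \<Rightarrow> (circle \<Rightarrow> real) \<Rightarrow> real set" where
  "mod_quotients \<omega> f = {\<bar>f x - f y\<bar> / \<omega> (dist x y) | x y. x \<noteq> y}"

text \<open>The real supremum is only meaningful for functions in \<open>C_mod \<omega>\<close>.\<close>

definition mod_seminorm :: "(real \<Rightarrow> real) \<Rightarrow> (circle \<Rightarrow> real) \<Rightarrow> real" where
  "mod_seminorm \<omega> f = Sup (mod_quotients \<omega> f)"

definition C_mod :: "(real \<Rightarrow> real) \<Rightarrow> (circle \<Rightarrow> real) set" where
  "C_mod \<omega> = {f. continuous_on UNIV f \<and> bdd_above (mod_quotients \<omega> f)}"

definition sup_norm :: "(circle \<Rightarrow> real) \<Rightarrow> real" where
  "sup_norm f = (SUP x. \<bar>f x\<bar>)"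

section \<open>Compatibility\<close>

definition preorbits :: "(real \<Rightarrow> real) \<Rightarrow> circle \<Rightarrow> (nat \<Rightarrow> circle) set" where
  "preorbits V x = {s. s 0 = x \<and> (\<forall>k. circle_map V (s (Suc k)) = s k)}"

definition T_compatible ::
  "(real \<Rightarrow> real) \<Rightarrow> (real \<Rightarrow> real) \<Rightarrow> (real \<Rightarrow> real) \<Rightarrow> real \<Rightarrow> real \<Rightarrow> bool" where
  "T_compatible V \<omega> \<Omega> \<rho> C \<longleftrightarrow>
     0 < \<rho> \<and> 0 < C \<and>
     (\<forall>x y. dist x y < \<rho> \<longrightarrow>
       (\<exists>B. bij_betw B (preorbits V x) (preorbits V y) \<and>
         (\<forall>s\<in>preorbits V x. \<forall>k.
            dist (s k) (B s k) \<le> dist x y \<and>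
            C * (\<Sum>j=1..k. \<omega> (dist (s j) (B s j))) \<le> \<Omega> (dist x y) - \<Omega> (dist (s k) (B s k)))))"

section \<open>Transfer operators\<close>

definition transfer ::
  "(real \<Rightarrow> real) \<Rightarrow> (circle \<Rightarrow> real) \<Rightarrow> (circle \<Rightarrow> real) \<Rightarrow> circle \<Rightarrow> real" where
  "transfer V g \<phi> x = (\<Sum>y\<in>circle_map V -` {x}. exp (g y) * \<phi> y)"

text \<open>
  The conclusion of the Ruelle--Perron--Frobenius theorem. The convergence clause determines \<open>eig\<close>
  and \<open>h\<close> uniquely.
\<close>

definition RPF_triple ::
  "(real \<Rightarrow> real) \<Rightarrow> (real \<Rightarrow> real) \<Rightarrow> (circle \<Rightarrow> real) \<Rightarrow>
   real \<Rightarrow> (circle \<Rightarrow> real) \<Rightarrow> circle measure \<Rightarrow> bool" where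
  "RPF_triple V \<Omega> f eig h \<nu> \<longleftrightarrow>
     0 < eig \<and> h \<in> C_mod \<Omega> \<and> (\<forall>x. 0 < h x) \<and>
     prob_space \<nu> \<and> sets \<nu> = sets borel \<and>
     (\<forall>x. transfer V f h x = eig * h x) \<and>
     (\<forall>\<psi>. continuous_on UNIV \<psi> \<longrightarrow> (\<integral>x. transfer V f \<psi> x \<partial>\<nu>) = eig * (\<integral>x. \<psi> x \<partial>\<nu>)) \<and>
     (\<integral>x. h x \<partial>\<nu>) = 1 \<and>
     (\<forall>\<psi>. continuous_on UNIV \<psi> \<longrightarrow>
        uniform_limit UNIV (\<lambda>n x. (transfer V f ^^ n) \<psi> x / eig ^ n)
          (\<lambda>x. h x * (\<integral>y. \<psi> y \<partial>\<nu>)) sequentially)"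

definition normalized_potential ::
  "(real \<Rightarrow> real) \<Rightarrow> (circle \<Rightarrow> real) \<Rightarrow> real \<Rightarrow> (circle \<Rightarrow> real) \<Rightarrow> circle \<Rightarrow> real" where
  "normalized_potential V f eig h x = f x + ln (h x) - ln (h (circle_map V x)) - ln eig"

section \<open>Constants\<close>

definition kappa :: "(real \<Rightarrow> real) \<Rightarrow> real \<Rightarrow> (circle \<Rightarrow> real) \<Rightarrow> real" where
  "kappa \<omega> C f = mod_seminorm \<omega> f / C"

text \<open>\<open>h\<close> is continuous on a compact space, so the supremum and infimum are attained.\<close>

definition Gamma_const ::
  "(real \<Rightarrow> real) \<Rightarrow> (real \<Rightarrow> real) \<Rightarrow> real \<Rightarrow> (circle \<Rightarrow> real) \<Rightarrow> (circle \<Rightarrow> real) \<Rightarrow> real" where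
  "Gamma_const \<omega> \<Omega> C f h =
     max (2 * kappa \<omega> C f * exp (2 * kappa \<omega> C f * \<Omega> (1/2)))
         (real_of_int \<lceil>(SUP x. h x) / (INF x. h x)\<rceil>)"

definition theta :: "(real \<Rightarrow> real) \<Rightarrow> (circle \<Rightarrow> real) \<Rightarrow> real \<Rightarrow> nat \<Rightarrow> real" where
  "theta V f eig n =
     1 / eig ^ n * sup_norm ((transfer V (\<lambda>x. f x - ln (1 + V (coord x))) ^^ n) (\<lambda>_. 1))"

text \<open>For concave \<open>\<Omega>\<close> the quotients below are bounded by \<open>max 1 (theta V f eig n)\<close>.\<close>

definition tau :: "(real \<Rightarrow> real) \<Rightarrow> (real \<Rightarrow> real) \<Rightarrow> (circle \<Rightarrow> real) \<Rightarrow> real \<Rightarrow> nat \<Rightarrow> real" where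
  "tau V \<Omega> f eig n = (SUP d\<in>{0<..<1/2}. \<Omega> (theta V f eig n * d) / \<Omega> d)"

end

theory Submission
  imports Defs
begin

text \<open>
  The iterate of the normalized operator is an average: its weights over the \<open>n\<close>-step preimages of
  a point sum to \<open>1\<close>. Compatibility pairs the preimages \<open>u\<close> of \<open>x\<close> with preimages \<open>v\<close> of \<open>y\<close>;
  since a shadowing preorbit is unique below the admissible radius, the bijection of infinite
  preorbits descends to \<open>n\<close>-step preimages. Distortion estimates compare the two weights up to
  \<open>exp (2 \<kappa> \<Omega> (d x y))\<close>, and Jensen's inequality for \<open>\<Omega>\<close> reduces the rest to bounding the weighted
  mean of \<open>d u v\<close>.

  One step expands \<open>d u v\<close> by the factor \<open>1 + V\<close> evaluated at either point, except when the arc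
  from \<open>u\<close> to \<open>v\<close> contains \<open>0\<close>, where \<open>V\<close> jumps. Such an arc is cut at \<open>0\<close>: each half is contracted
  by the factors along its own endpoint's orbit, and weighting the pair by the minimum of the two
  weights allows each half to be summed with the weights of its own endpoint. Both sums are
  bounded by \<open>\<theta> n\<close>, and the two half lengths add up to \<open>d x y\<close>.
\<close>

section \<open>The circle metric in terms of real representatives\<close>

lemma circle_of_coord [simp]: "circle_of (coord x) = x"
proof -
  have "frac (coord x) = coord x"
    using coord_bounds[of x] by (simp add: frac_eq)
  then show ?thesis
    by (simp add: circle_of_def coord_inverse)
qed

lemma circle_of_eq_iff: "circle_of a = circle_of b \<longleftrightarrow> a - b \<in> \<int>"
proof
  assume "circle_of a = circle_of b"
  then have "frac a = frac b"
    by (metis coord_circle_of)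
  then have "a - b = of_int (\<lfloor>a\<rfloor> - \<lfloor>b\<rfloor>)"
    by (simp add: frac_def)
  then show "a - b \<in> \<int>" by (metis Ints_of_int)
next
  assume "a - b \<in> \<int>"
  then obtain m where "a - b = of_int m" by (auto elim: Ints_cases)
  then have "a = b + of_int m" by simp
  then show "circle_of a = circle_of b" by (simp add: circle_of_def)
qed

lemma dist_circle_alt:
  "dist x y = min \<bar>coord x - coord y\<bar> (1 - \<bar>coord x - coord y\<bar>)"
  using coord_bounds[of x] coord_bounds[of y]
  by (auto simp: dist_circle_def min_def abs_if)

lemma dist_circle_le_half: "dist (x::circle) y \<le> 1/2"
  unfolding dist_circle_alt by (auto simp: min_def)

text \<open>The fractional parts differ by \<open>a - b\<close> minus an integer \<open>m\<close>.
  For \<open>m = 0\<close> the direct branch of the metric is at most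
  \<open>\<bar>a - b\<bar>\<close>; for \<open>m \<noteq> 0\<close> the wrapped branch is.\<close>

lemma dist_circle_of_le: "dist (circle_of a) (circle_of b) \<le> \<bar>a - b\<bar>"
proof -
  define m where "m = \<lfloor>a\<rfloor> - \<lfloor>b\<rfloor>"
  have e: "frac a - frac b = a - b - of_int m" by (simp add: frac_def m_def)
  have f: "0 \<le> frac a" "frac a < 1" "0 \<le> frac b" "frac b < 1" by (simp_all add: frac_lt_1)
  consider "m = 0" | "real_of_int m \<ge> 1" | "real_of_int m \<le> -1" by linarith
  then show ?thesis
    unfolding dist_circle_alt coord_circle_of using e f by cases linarith+
qed

lemma dist_circle_of_eq:
  assumes "\<bar>a - b\<bar> \<le> 1/2"
  shows "dist (circle_of a) (circle_of b) = \<bar>a - b\<bar>"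
proof -
  define m where "m = \<lfloor>a\<rfloor> - \<lfloor>b\<rfloor>"
  have e: "frac a - frac b = a - b - of_int m" by (simp add: frac_def m_def)
  have f: "0 \<le> frac a" "frac a < 1" "0 \<le> frac b" "frac b < 1" by (simp_all add: frac_lt_1)
  have "real_of_int m < 2" "real_of_int m > -2" using e f assms by linarith+
  then have "m = 0 \<or> m = 1 \<or> m = -1" by linarith
  then consider "real_of_int m = 0" | "real_of_int m = 1" | "real_of_int m = -1" by auto
  then show ?thesis
    unfolding dist_circle_alt coord_circle_of using e f assms by cases linarith+
qed

text \<open>Walks along a shortest arc in \<open>M\<close> equal steps. It carries estimates for
  points closer than \<open>r\<close> over to arbitrary pairs.\<close>

lemma circle_chain:
  fixes x y :: circle
  assumes "0 < M"
  obtains z :: "nat \<Rightarrow> circle"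
  where "z 0 = x" "z M = y" "\<And>k. dist (z k) (z (Suc k)) \<le> dist x y / real M"
proof -
  \<comment> \<open>\<open>\<delta>\<close> is the signed length of a shortest arc from
    \<open>x\<close> to \<open>y\<close>; if that arc passes through 0, the coordinate difference is
    corrected by 1 or -1.\<close>
  have "\<exists>\<delta>. \<bar>\<delta>\<bar> = dist x y \<and> circle_of (coord x + \<delta>) = y"
  proof (cases "\<bar>coord x - coord y\<bar> \<le> 1/2")
    case True
    then show ?thesis
      by (intro exI[of _ "coord y - coord x"]) (auto simp: dist_circle_alt)
  next
    case False
    define \<delta> where "\<delta> = coord y - coord x + (if coord y < coord x then 1 else -1)"
    have "circle_of (coord x + \<delta>) = circle_of (coord y)"
      unfolding circle_of_eq_iff \<delta>_def by simp
    moreover have "\<bar>\<delta>\<bar> = dist x y"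
      using False coord_bounds[of x] coord_bounds[of y]
      by (auto simp: dist_circle_alt \<delta>_def)
    ultimately show ?thesis by auto
  qed
  then obtain \<delta> where \<delta>: "\<bar>\<delta>\<bar> = dist x y" "circle_of (coord x + \<delta>) = y" by blast
  define z where "z k = circle_of (coord x + real k * (\<delta> / real M))" for k
  show thesis
  proof
    show "z 0 = x" "z M = y" using \<delta> assms by (auto simp: z_def)
    fix k
    have "dist (z k) (z (Suc k)) \<le> \<bar>(coord x + real k * (\<delta> / real M)) - (coord x + real (Suc k) * (\<delta> / real M))\<bar>"
      unfolding z_def by (rule dist_circle_of_le)
    also have "\<dots> = dist x y / real M"
      using \<delta> by (simp add: algebra_simps add_divide_distrib)
    finally show "dist (z k) (z (Suc k)) \<le> dist x y / real M" .
  qed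
qed

section \<open>Moduli of continuity, seminorms and the sup norm\<close>

lemma modulus_mono: "modulus_of_continuity \<omega> \<Longrightarrow> 0 \<le> s \<Longrightarrow> s \<le> t \<Longrightarrow> \<omega> s \<le> \<omega> t"
  by (auto simp: modulus_of_continuity_def mono_on_def)

lemma modulus_nonneg: "modulus_of_continuity \<omega> \<Longrightarrow> 0 \<le> t \<Longrightarrow> 0 \<le> \<omega> t"
  using modulus_mono[of \<omega> 0 t] by (simp add: modulus_of_continuity_def)

text \<open>The circle has two distinct points, so \<open>mod_seminorm\<close> never takes the
  supremum of the empty set.\<close>

lemma mod_quotients_nonempty: "mod_quotients \<omega> f \<noteq> {}"
proof -
  have "circle_of 0 \<noteq> circle_of (1/2)"
    using dist_circle_of_eq[of 0 "1/2"] by auto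
  then show ?thesis unfolding mod_quotients_def by blast
qed

lemma mod_seminorm_bound:
  assumes "modulus_of_continuity \<omega>" "f \<in> C_mod \<omega>"
  shows "\<bar>f x - f y\<bar> \<le> mod_seminorm \<omega> f * \<omega> (dist x y)"
proof (cases "x = y")
  case False
  then have "\<bar>f x - f y\<bar> / \<omega> (dist x y) \<in> mod_quotients \<omega> f"
    unfolding mod_quotients_def by blast
  then have "\<bar>f x - f y\<bar> / \<omega> (dist x y) \<le> mod_seminorm \<omega> f"
    using assms(2) unfolding mod_seminorm_def C_mod_def by (intro cSup_upper) auto
  moreover have "0 < \<omega> (dist x y)"
    using False assms(1) by (simp add: modulus_of_continuity_def)
  ultimately show ?thesis by (simp only: pos_divide_le_eq)
qed (use assms in \<open>simp add: modulus_of_continuity_def\<close>)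

lemma mod_seminorm_nonneg:
  assumes "modulus_of_continuity \<omega>" "f \<in> C_mod \<omega>"
  shows "0 \<le> mod_seminorm \<omega> f"
proof -
  obtain q where q: "q \<in> mod_quotients \<omega> f" using mod_quotients_nonempty by blast
  then obtain x y where "q = \<bar>f x - f y\<bar> / \<omega> (dist x y)"
    unfolding mod_quotients_def by blast
  then have "0 \<le> q" using modulus_nonneg[OF assms(1), of "dist x y"] by simp
  also have "q \<le> mod_seminorm \<omega> f"
    unfolding mod_seminorm_def using q
    by (rule cSup_upper) (use assms(2) in \<open>simp add: C_mod_def\<close>)
  finally show ?thesis .
qed

lemma mod_quotients_le:
  assumes "modulus_of_continuity \<omega>" "\<And>x y. \<bar>f x - f y\<bar> \<le> c * \<omega> (dist x y)"
    and "q \<in> mod_quotients \<omega> f"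
  shows "q \<le> c"
proof -
  obtain x y where q: "q = \<bar>f x - f y\<bar> / \<omega> (dist x y)" "x \<noteq> y"
    using assms(3) unfolding mod_quotients_def by blast
  then have "0 < \<omega> (dist x y)" using assms(1) by (simp add: modulus_of_continuity_def)
  with assms(2)[of x y] show ?thesis unfolding q(1) by (simp only: pos_divide_le_eq)
qed

lemma mod_seminorm_le:
  assumes "modulus_of_continuity \<omega>" "\<And>x y. \<bar>f x - f y\<bar> \<le> c * \<omega> (dist x y)"
  shows "mod_seminorm \<omega> f \<le> c"
  unfolding mod_seminorm_def
  using mod_quotients_nonempty mod_quotients_le[OF assms] by (rule cSup_least)

text \<open>Continuity follows from the bound as well, because \<open>\<omega>\<close> is continuous
  at 0 with value 0.\<close>

lemma C_mod_intro:
  assumes \<omega>: "modulus_of_continuity \<omega>" and b: "\<And>x y. \<bar>f x - f y\<bar> \<le> c * \<omega> (dist x y)"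
  shows "f \<in> C_mod \<omega>"
proof -
  have "isCont f x" for x
  proof -
    have "((\<lambda>y. dist y x) \<longlongrightarrow> 0) (at x)"
      using tendsto_dist[OF tendsto_ident_at tendsto_const, of x x UNIV] by simp
    with \<omega> have "((\<lambda>y. \<omega> (dist y x)) \<longlongrightarrow> \<omega> 0) (at x)"
      by (intro continuous_on_tendsto_compose[of "{0..}" \<omega>]) (auto simp: modulus_of_continuity_def)
    then have "((\<lambda>y. c * \<omega> (dist y x)) \<longlongrightarrow> 0) (at x)"
      using \<omega> by (intro tendsto_mult_right_zero) (simp add: modulus_of_continuity_def)
    then have "((\<lambda>y. dist (f y) (f x)) \<longlongrightarrow> 0) (at x)"
      by (rule Lim_null_comparison[rotated]) (intro always_eventually allI, simp add: dist_real_def b)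
    then show ?thesis unfolding isCont_def by (rule iffD2[OF tendsto_dist_iff])
  qed
  then have "continuous_on UNIV f" by (simp add: continuous_at_imp_continuous_on)
  moreover have "bdd_above (mod_quotients \<omega> f)"
    by (rule bdd_aboveI) (rule mod_quotients_le[OF assms])
  ultimately show ?thesis by (simp add: C_mod_def)
qed

text \<open>The circle has diameter \<open>1/2\<close>, so a finite seminorm bounds the function.
  This makes \<open>sup_norm\<close> a genuine supremum on \<open>C_mod\<close>.\<close>

lemma C_mod_abs_le:
  assumes "modulus_of_continuity \<omega>" "f \<in> C_mod \<omega>"
  shows "\<bar>f x\<bar> \<le> \<bar>f y\<bar> + mod_seminorm \<omega> f * \<omega> (1/2)"
proof -
  have "\<bar>f x - f y\<bar> \<le> mod_seminorm \<omega> f * \<omega> (dist x y)"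
    by (rule mod_seminorm_bound[OF assms])
  also have "\<dots> \<le> mod_seminorm \<omega> f * \<omega> (1/2)"
    by (intro mult_left_mono modulus_mono[OF assms(1)] mod_seminorm_nonneg[OF assms]
        zero_le_dist dist_circle_le_half)
  finally show ?thesis by linarith
qed

lemma abs_le_sup_norm:
  assumes "modulus_of_continuity \<omega>" "f \<in> C_mod \<omega>"
  shows "\<bar>f x\<bar> \<le> sup_norm f"
  unfolding sup_norm_def
  by (rule cSUP_upper[OF UNIV_I]) (rule bdd_aboveI2, rule C_mod_abs_le[OF assms])

section \<open>Concave moduli and elementary inequalities\<close>

lemma concave_modulus_scale:
  assumes "modulus_of_continuity \<Omega>" "concave_on {0..} \<Omega>" "0 \<le> c" "c \<le> 1" "0 \<le> t"
  shows "c * \<Omega> t \<le> \<Omega> (c * t)"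
  using concave_onD[OF assms(2), of c 0 t] assms by (simp add: modulus_of_continuity_def)

lemma concave_modulus_le_mult:
  assumes "modulus_of_continuity \<Omega>" "concave_on {0..} \<Omega>" "1 \<le> c" "0 \<le> t"
  shows "\<Omega> (c * t) \<le> c * \<Omega> t"
  using concave_modulus_scale[OF assms(1,2), of "1 / c" "c * t"] assms(3,4)
  by (simp add: field_simps)

text \<open>Jensen's inequality for weights of total mass at most 1. The missing mass is placed at
  0, where \<open>\<Omega>\<close> vanishes: each \<open>d i\<close> shrinks by the factor
  \<open>m i / p i \<le> 1\<close>, and the probability weights \<open>p\<close> take over. It will
  be applied with \<open>m\<close> the minimum of two weights.\<close>

lemma concave_modulus_sum:
  assumes "modulus_of_continuity \<Omega>" "concave_on {0..} \<Omega>" "finite S" "sum p S = 1"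
    and "\<And>i. i \<in> S \<Longrightarrow> 0 < p i" "\<And>i. i \<in> S \<Longrightarrow> 0 \<le> m i \<and> m i \<le> p i" "\<And>i. i \<in> S \<Longrightarrow> 0 \<le> d i"
  shows "(\<Sum>i\<in>S. m i * \<Omega> (d i)) \<le> \<Omega> (\<Sum>i\<in>S. m i * d i)"
proof -
  have "(\<Sum>i\<in>S. m i * \<Omega> (d i)) \<le> (\<Sum>i\<in>S. p i * \<Omega> (m i / p i * d i))"
  proof (rule sum_mono)
    fix i assume i: "i \<in> S"
    have "p i * (m i / p i * \<Omega> (d i)) \<le> p i * \<Omega> (m i / p i * d i)"
      using assms(5-7)[OF i] by (intro mult_left_mono concave_modulus_scale assms(1,2)) auto
    then show "m i * \<Omega> (d i) \<le> p i * \<Omega> (m i / p i * d i)"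
      using assms(5)[OF i] by simp
  qed
  also have "\<dots> \<le> \<Omega> (\<Sum>i\<in>S. p i *\<^sub>R (m i / p i * d i))"
  proof (rule concave_on_sum[OF assms(3) _ assms(2) assms(4)])
    show "S \<noteq> {}" using assms(4) by auto
    fix i assume i: "i \<in> S"
    show "0 \<le> p i" "m i / p i * d i \<in> {0..}" using assms(5-7)[OF i] by auto
  qed
  also have "(\<Sum>i\<in>S. p i *\<^sub>R (m i / p i * d i)) = (\<Sum>i\<in>S. m i * d i)"
  proof (rule sum.cong)
    fix i assume "i \<in> S"
    then show "p i *\<^sub>R (m i / p i * d i) = m i * d i" using assms(5)[of i] by simp
  qed simp
  finally show ?thesis .
qed

text \<open>Splitting off the smaller of the two weights puts \<open>min a b\<close> in front of the
  oscillation, so that this term can later be bounded with either weight.\<close>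

lemma abs_weighted_diff_le:
  fixes a b :: real
  assumes "0 \<le> a" "0 \<le> b" "\<bar>\<alpha>\<bar> \<le> S" "\<bar>\<beta>\<bar> \<le> S"
  shows "\<bar>a * \<alpha> - b * \<beta>\<bar> \<le> min a b * \<bar>\<alpha> - \<beta>\<bar> + \<bar>a - b\<bar> * S"
proof (cases "a \<le> b")
  case True
  have "a * \<alpha> - b * \<beta> = a * (\<alpha> - \<beta>) + (a - b) * \<beta>" by (simp add: algebra_simps)
  then have "\<bar>a * \<alpha> - b * \<beta>\<bar> \<le> a * \<bar>\<alpha> - \<beta>\<bar> + \<bar>a - b\<bar> * \<bar>\<beta>\<bar>"
    using assms(1) by (metis abs_mult abs_of_nonneg abs_triangle_ineq)
  also have "\<dots> \<le> a * \<bar>\<alpha> - \<beta>\<bar> + \<bar>a - b\<bar> * S" using assms by (intro add_left_mono mult_left_mono) auto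
  finally show ?thesis using True by simp
next
  case False
  have "a * \<alpha> - b * \<beta> = b * (\<alpha> - \<beta>) + (a - b) * \<alpha>" by (simp add: algebra_simps)
  then have "\<bar>a * \<alpha> - b * \<beta>\<bar> \<le> b * \<bar>\<alpha> - \<beta>\<bar> + \<bar>a - b\<bar> * \<bar>\<alpha>\<bar>"
    using assms(2) by (metis abs_mult abs_of_nonneg abs_triangle_ineq)
  also have "\<dots> \<le> b * \<bar>\<alpha> - \<beta>\<bar> + \<bar>a - b\<bar> * S" using assms by (intro add_left_mono mult_left_mono) auto
  finally show ?thesis using False by simp
qed

text \<open>Both directions come from \<open>1 - c \<le> exp (- c)\<close>, which also gives
  \<open>exp c - 1 \<le> c * exp c\<close>. With
  \<open>c = 2 * \<kappa> * \<Omega> (dist x y)\<close> this produces the first constant in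
  \<open>Gamma_const\<close>.\<close>

lemma abs_diff_le_of_exp_ratio:
  fixes a b :: real
  assumes "0 \<le> b" "0 \<le> c" "a \<le> exp c * b" "b \<le> exp c * a"
  shows "\<bar>a - b\<bar> \<le> c * exp c * b"
proof -
  have e: "1 - c \<le> exp (- c)" using exp_ge_add_one_self[of "- c"] by simp
  have "exp c * (1 - c) \<le> exp c * exp (- c)" using e by (rule mult_left_mono) simp
  then have 1: "exp c - 1 \<le> c * exp c" by (simp add: algebra_simps flip: exp_add)
  have "exp (- c) * b \<le> exp (- c) * (exp c * a)" using assms(4) by (rule mult_left_mono) simp
  then have "exp (- c) * b \<le> a" by (simp flip: mult.assoc exp_add)
  moreover have "(1 - c) * b \<le> exp (- c) * b" using e assms(1) by (rule mult_right_mono)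
  moreover have "c * b \<le> c * exp c * b" using assms by (simp add: mult_le_cancel_left1 mult_right_mono)
  moreover have "(exp c - 1) * b \<le> c * exp c * b" using 1 assms(1) by (rule mult_right_mono)
  ultimately show ?thesis using assms(3) by (simp add: abs_le_iff algebra_simps)
qed

section \<open>The lift of the map and its local injectivity\<close>

locale circle_dynamics =
  fixes V :: "real \<Rightarrow> real" and \<rho> :: real
  assumes V: "admissible_V V"
    and radius: "admissible_radius V \<rho>"
begin

abbreviation T :: "circle \<Rightarrow> circle" where "T \<equiv> circle_map V"

definition lift :: "real \<Rightarrow> real" where "lift t = t * (1 + V t)"

definition N :: real where "N = 1 + V 1"

lemma V_nonneg: "0 \<le> t \<Longrightarrow> 0 \<le> V t"
  using V by (auto simp: admissible_V_def)

lemma V_mono: "0 \<le> s \<Longrightarrow> s \<le> t \<Longrightarrow> V s \<le> V t"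
  using V by (auto simp: admissible_V_def mono_on_def)

lemma N_eq: "N = real (num_branches V)" and N_ge_2: "2 \<le> N"
proof -
  obtain m :: nat where "0 < m" "V 1 = real m"
    using V by (auto simp: admissible_V_def)
  then show "N = real (num_branches V)" "2 \<le> N"
    by (auto simp: N_def num_branches_def)
qed

lemma T_eq: "T u = circle_of (lift (coord u))"
  by (simp add: circle_map_def lift_def)

text \<open>The two sides differ by \<open>s * (V t - V s)\<close>. The expansion factor is the one
  at the right endpoint, the larger of the two, so expansion holds with the factor of either
  endpoint.\<close>

lemma lift_diff:
  assumes "0 \<le> s" "s \<le> t"
  shows "(t - s) * (1 + V t) \<le> lift t - lift s"
proof -
  have "0 \<le> s * (V t - V s)" using assms V_mono[of s t] by simp
  then show ?thesis by (simp add: lift_def algebra_simps)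
qed

lemma lift_strict_mono:
  assumes "0 \<le> s" "s < t"
  shows "lift s < lift t"
proof -
  have "0 < (t - s) * (1 + V t)" using assms V_nonneg[of t] by (intro mult_pos_pos) auto
  then show ?thesis using lift_diff[of s t] assms by linarith
qed

lemma lift_0: "lift 0 = 0" and lift_1: "lift 1 = N"
  by (simp_all add: lift_def N_def)

lemma lift_bounds: "0 \<le> t \<Longrightarrow> t < 1 \<Longrightarrow> 0 \<le> lift t \<and> lift t < N"
  using lift_strict_mono[of t 1] lift_1 V_nonneg[of t] by (auto simp: lift_def)

lemma T_surj: "\<exists>u. T u = x"
proof -
  have "continuous_on {0..1} lift"
    unfolding lift_def using V
    by (intro continuous_intros) (auto simp: admissible_V_def intro: continuous_on_subset)
  moreover have "lift 0 \<le> coord x" "coord x \<le> lift 1"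
    using coord_bounds[of x] N_ge_2 by (auto simp: lift_0 lift_1)
  ultimately obtain t where t: "0 \<le> t" "t \<le> 1" "lift t = coord x"
    using IVT'[of lift 0 "coord x" 1] by auto
  \<comment> \<open>The endpoint 1 has to be excluded for \<open>t\<close> to be the coordinate of a
    point; there \<open>lift\<close> takes the value \<open>N \<ge> 2\<close>.\<close>
  then have "t \<noteq> 1" using coord_bounds[of x] N_ge_2 lift_1 by auto
  then have "coord (circle_of t) = t" using t by (simp add: coord_circle_of frac_eq)
  then show ?thesis using t by (intro exI[of _ "circle_of t"]) (simp add: T_eq)
qed

text \<open>The integer part of \<open>lift\<close> names the branch of a preimage. Its fractional
  part is \<open>coord x\<close>, so strict monotonicity leaves one preimage per branch.\<close>

lemma finite_preimage: "finite (T -` {x})"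
proof (rule inj_on_finite)
  show "inj_on (\<lambda>u. \<lfloor>lift (coord u)\<rfloor>) (T -` {x})"
  proof (rule inj_onI)
    fix u v assume "u \<in> T -` {x}" "v \<in> T -` {x}" and fl: "\<lfloor>lift (coord u)\<rfloor> = \<lfloor>lift (coord v)\<rfloor>"
    then have "coord (T u) = coord (T v)" by simp
    then have "lift (coord u) = lift (coord v)"
      unfolding T_eq coord_circle_of frac_def using fl by simp
    then have "coord u = coord v"
      using lift_strict_mono[of "coord u" "coord v"] lift_strict_mono[of "coord v" "coord u"]
        coord_bounds[of u] coord_bounds[of v] by (cases "coord u" "coord v" rule: linorder_cases) auto
    then show "u = v" by (simp add: coord_inject)
  qed
  show "(\<lambda>u. \<lfloor>lift (coord u)\<rfloor>) ` (T -` {x}) \<subseteq> {0..\<lfloor>N\<rfloor>}"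
  proof clarsimp
    fix u
    show "0 \<le> lift (coord u) \<and> \<lfloor>lift (coord u)\<rfloor> \<le> \<lfloor>N\<rfloor>"
      using lift_bounds[OF coord_bounds, of u] by (auto intro: floor_mono)
  qed
qed simp

text \<open>Rests on the uniform closeness condition in \<open>admissible_radius\<close>, through
  the decomposition \<open>(t - s) * (1 + V s) + t * (V t - V s)\<close> of the increment.\<close>

lemma lift_close:
  assumes "0 \<le> s" "s \<le> t" "t < 1" "t - s < \<rho>"
  shows "lift t - lift s < 1/2"
proof -
  have "\<bar>t - s\<bar> * N + \<bar>V t - V s\<bar> < 1/2"
    using radius assms unfolding admissible_radius_def N_eq
    by (metis abs_of_nonneg atLeastAtMost_iff diff_ge_0_iff_ge less_eq_real_def order_trans)
  moreover have "lift t - lift s \<le> \<bar>t - s\<bar> * N + \<bar>V t - V s\<bar>"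
  proof -
    have "(t - s) * (1 + V s) \<le> (t - s) * N"
      using assms V_mono[of s 1] by (intro mult_left_mono) (auto simp: N_def)
    moreover have "t * (V t - V s) \<le> 1 * (V t - V s)"
      using assms V_mono[of s t] by (intro mult_right_mono) auto
    moreover have "lift t - lift s = (t - s) * (1 + V s) + t * (V t - V s)"
      by (simp add: lift_def algebra_simps)
    moreover have "\<bar>t - s\<bar> = t - s" "\<bar>V t - V s\<bar> = V t - V s"
      using assms V_mono[of s t] by auto
    ultimately show ?thesis by simp
  qed
  ultimately show ?thesis by linarith
qed

text \<open>The counterpart for a short arc through 0, from the last condition in
  \<open>admissible_radius\<close>: \<open>t \<mapsto> t * V t\<close> is monotone, so the extreme
  case is \<open>s = \<rho>\<close>, \<open>t = 1 - \<rho>\<close>.\<close>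

lemma lift_close_wrapped:
  assumes "0 \<le> s" "s < 1" "0 \<le> t" "t < 1" "s + (1 - t) < \<rho>"
  shows "lift s + (N - lift t) < 1/2"
proof -
  have r: "\<rho> + \<rho> * V \<rho> + V 1 - (1 - \<rho>) * V (1 - \<rho>) < 1/2" "\<rho> < 1/2" "0 < \<rho>"
    using radius by (auto simp: admissible_radius_def)
  have "s * V s \<le> \<rho> * V \<rho>"
    using assms r V_mono[of s \<rho>] V_nonneg[of s] by (intro mult_mono) auto
  moreover have "(1 - \<rho>) * V (1 - \<rho>) \<le> t * V t"
    using assms r V_mono[of "1 - \<rho>" t] V_nonneg[of "1 - \<rho>"] by (intro mult_mono) auto
  ultimately show ?thesis using assms r by (simp add: lift_def N_def algebra_simps)
qed

text \<open>A full turn of the circle changes \<open>lift\<close> by \<open>N\<close>, so the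
  displacement is controlled only modulo \<open>N\<close>; the correction \<open>k\<close> is 0
  unless the short arc passes through 0, when it is 1 or -1.\<close>

lemma lift_close_mod_N:
  assumes "dist u v < \<rho>"
  shows "\<exists>k::int. \<bar>lift (coord v) - lift (coord u) - of_int k * N\<bar> < 1/2"
proof -
  have r: "\<rho> < 1/2" using radius by (auto simp: admissible_radius_def)
  note b = coord_bounds[of u] coord_bounds[of v]
  consider "\<bar>coord u - coord v\<bar> < \<rho>" | "1 - (coord u - coord v) < \<rho>" | "1 - (coord v - coord u) < \<rho>"
    using assms unfolding dist_circle_alt by linarith
  then show ?thesis
  proof cases
    case 1
    have "\<bar>lift (coord v) - lift (coord u)\<bar> < 1/2"
    proof (cases "coord u \<le> coord v")
      case True
      then show ?thesis using lift_close[of "coord u" "coord v"] lift_diff[of "coord u" "coord v"]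
        V_nonneg[of "coord v"] b 1 by (smt (verit) zero_le_mult_iff)
    next
      case False
      then show ?thesis using lift_close[of "coord v" "coord u"] lift_diff[of "coord v" "coord u"]
        V_nonneg[of "coord u"] b 1 by (smt (verit) zero_le_mult_iff)
    qed
    then show ?thesis by (intro exI[of _ 0]) simp
  next
    case 2
    then show ?thesis
      using lift_close_wrapped[of "coord v" "coord u"] lift_bounds[of "coord u"] lift_bounds[of "coord v"] b
      by (intro exI[of _ "-1"]) auto
  next
    case 3
    then show ?thesis
      using lift_close_wrapped[of "coord u" "coord v"] lift_bounds[of "coord u"] lift_bounds[of "coord v"] b
      by (intro exI[of _ 1]) auto
  qed
qed

text \<open>Since \<open>T v = T v'\<close>, the lifts differ by an integer \<open>a\<close>. Both
  are within \<open>1/2\<close> of the lift of \<open>u\<close> modulo \<open>N\<close>, so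
  \<open>a\<close> is a multiple of \<open>N\<close>; as \<open>\<bar>a\<bar> < N\<close>, it
  vanishes.\<close>

lemma preimage_unique:
  assumes "dist u v < \<rho>" "dist u v' < \<rho>" "T v = T v'"
  shows "v = v'"
proof -
  define a where "a = lift (coord v) - lift (coord v')"
  obtain k k' :: int
    where k: "\<bar>lift (coord v) - lift (coord u) - of_int k * N\<bar> < 1/2"
             "\<bar>lift (coord v') - lift (coord u) - of_int k' * N\<bar> < 1/2"
    using assms lift_close_mod_N by meson
  have "a \<in> \<int>" using assms(3) by (simp add: T_eq circle_of_eq_iff a_def)
  moreover have "of_int (k - k') * N \<in> \<int>" unfolding N_eq by simp
  ultimately obtain i :: int where i: "a - of_int (k - k') * N = of_int i"
    by (meson Ints_cases Ints_diff)
  have "\<bar>a - of_int (k - k') * N\<bar> < 1" using k by (simp add: a_def left_diff_distrib del: less_divide_eq_numeral1)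
  then have "i = 0" using i by linarith
  then have a: "a = of_int (k - k') * N" using i by simp
  moreover have "\<bar>a\<bar> < N"
    using lift_bounds[of "coord v"] lift_bounds[of "coord v'"] coord_bounds by (auto simp: a_def)
  ultimately have "\<bar>real_of_int (k - k')\<bar> * N < 1 * N"
    using N_ge_2 by (simp add: abs_mult)
  then have "k - k' = 0" using N_ge_2 by (simp only: mult_less_cancel_right) linarith
  then have "lift (coord v) = lift (coord v')" using a by (simp add: a_def)
  then have "coord v = coord v'"
    using lift_strict_mono[of "coord v" "coord v'"] lift_strict_mono[of "coord v'" "coord v"]
      coord_bounds[of v] coord_bounds[of v'] by (cases "coord v" "coord v'" rule: linorder_cases) auto
  then show ?thesis by (simp add: coord_inject)
qed

section \<open>Contraction of arcs cut at 0\<close>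

text \<open>
  \<open>\<alpha>\<close> and \<open>\<beta>\<close> bound the two parts of the arc from \<open>u\<close> to \<open>v\<close>; the cut is forced to be at \<open>0\<close> when
  the shorter arc passes through \<open>0\<close> and is arbitrary otherwise.
\<close>

definition splits :: "circle \<Rightarrow> circle \<Rightarrow> real \<Rightarrow> real \<Rightarrow> bool" where
  "splits u v \<alpha> \<beta> \<longleftrightarrow> 0 \<le> \<alpha> \<and> 0 \<le> \<beta> \<and> dist u v \<le> \<alpha> + \<beta> \<and>
     (1/2 < \<bar>coord u - coord v\<bar> \<longrightarrow>
        dist u (circle_of 0) \<le> \<alpha> \<and> dist v (circle_of 0) \<le> \<beta>)"

lemma splits_commute: "splits u v \<alpha> \<beta> \<longleftrightarrow> splits v u \<beta> \<alpha>"
  by (auto simp: splits_def dist_commute abs_minus_commute add.commute)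

lemma ex_splits: "\<exists>\<alpha> \<beta>. splits x y \<alpha> \<beta> \<and> \<alpha> + \<beta> = dist x y"
proof (cases "1/2 < \<bar>coord x - coord y\<bar>")
  case True
  then have "dist x (circle_of 0) + dist y (circle_of 0) = dist x y"
    using coord_bounds[of x] coord_bounds[of y]
    by (auto simp: dist_circle_alt coord_circle_of min_def abs_if split: if_splits)
  then show ?thesis
    by (intro exI[of _ "dist x (circle_of 0)"] exI[of _ "dist y (circle_of 0)"]) (simp add: splits_def)
next
  case False
  then show ?thesis by (intro exI[of _ "dist x y"] exI[of _ 0]) (simp add: splits_def)
qed

text \<open>If the arc from \<open>u\<close> to \<open>v\<close> avoids 0, only the total length of
  the image arc matters, and the larger of the two factors contracts it. If it passes through 0, so
  does its image, and the halves on either side of 0 contract separately.\<close>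

lemma splits_pullback:
  assumes "dist u v < \<rho>" and S: "splits (T u) (T v) \<alpha> \<beta>"
  shows "splits u v (\<alpha> / (1 + V (coord u))) (\<beta> / (1 + V (coord v)))"
  using assms
proof (induction "coord u" "coord v" arbitrary: u v \<alpha> \<beta> rule: linorder_wlog)
  case sym
  then show ?case by (metis splits_commute dist_commute)
next
  case (le u v \<alpha> \<beta>)
  have r: "\<rho> < 1/2" using radius by (auto simp: admissible_radius_def)
  note b = coord_bounds[of u] coord_bounds[of v]
  have Vu: "0 \<le> V (coord u)" and Vv: "0 \<le> V (coord v)" and Vle: "V (coord u) \<le> V (coord v)"
    using V_nonneg V_mono le(1) b by auto
  have \<alpha>: "0 \<le> \<alpha>" and \<beta>: "0 \<le> \<beta>" and d: "dist (T u) (T v) \<le> \<alpha> + \<beta>"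
    using le(3) by (auto simp: splits_def)
  show ?case
  proof (cases "1/2 < \<bar>coord u - coord v\<bar>")
    case False
    then have duv: "dist u v = coord v - coord u" using le(1) b by (auto simp: dist_circle_alt)
    have "\<bar>lift (coord u) - lift (coord v)\<bar> = lift (coord v) - lift (coord u)"
      using lift_diff[of "coord u" "coord v"] le(1) b Vv by (smt (verit) mult_nonneg_nonneg)
    then have "dist (T u) (T v) = lift (coord v) - lift (coord u)"
      unfolding T_eq using lift_close[of "coord u" "coord v"] le(1,2) duv b
      by (subst dist_circle_of_eq) auto
    then have "dist u v * (1 + V (coord v)) \<le> \<alpha> + \<beta>"
      using lift_diff[of "coord u" "coord v"] le(1) b d duv by auto
    then have "dist u v \<le> \<alpha> / (1 + V (coord v)) + \<beta> / (1 + V (coord v))"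
      using Vv by (simp add: pos_le_divide_eq flip: add_divide_distrib)
    \<comment> \<open>\<open>coord u \<le> coord v\<close>, so the factor at \<open>u\<close> is the
      smaller one and inserting it only weakens the bound.\<close>
    also have "\<alpha> / (1 + V (coord v)) \<le> \<alpha> / (1 + V (coord u))"
      using \<alpha> Vu Vle by (intro divide_left_mono) auto
    finally have "dist u v \<le> \<alpha> / (1 + V (coord u)) + \<beta> / (1 + V (coord v))" by simp
    then show ?thesis using \<alpha> \<beta> Vu Vv False by (simp add: splits_def)
  next
    case True
    let ?s = "coord u" and ?t = "coord v"
    have duv: "dist u v = ?s + (1 - ?t)" using True le(1) b by (auto simp: dist_circle_alt)
    have c: "lift ?s + (N - lift ?t) < 1/2"
      using lift_close_wrapped[of ?s ?t] le(2) duv b by auto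
    have lb: "0 \<le> lift ?s" "lift ?t < N" using lift_bounds b by auto
    have Tu: "coord (T u) = lift ?s"
      unfolding T_eq coord_circle_of using c lb by (simp add: frac_eq)
    have "T v = circle_of (1 - (N - lift ?t))"
      unfolding T_eq circle_of_eq_iff N_eq by simp
    then have Tv: "coord (T v) = 1 - (N - lift ?t)"
      using c lb unfolding coord_circle_of by (simp add: coord_circle_of frac_eq)
    \<comment> \<open>The image arc again crosses 0, which activates the forced cut in the
      hypothesis.\<close>
    have "1/2 < \<bar>coord (T u) - coord (T v)\<bar>" unfolding Tu Tv using c lb by linarith
    then have "dist (T u) (circle_of 0) \<le> \<alpha>" "dist (T v) (circle_of 0) \<le> \<beta>"
      using le(3) by (auto simp: splits_def)
    then have "lift ?s \<le> \<alpha>" "N - lift ?t \<le> \<beta>"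
      using c lb by (auto simp: dist_circle_alt coord_circle_of Tu Tv min_def split: if_splits)
    \<comment> \<open>On the half ending at 1, \<open>lift_diff\<close> gives the factor
      \<open>1 + V 1\<close>, which dominates the factor at \<open>v\<close>.\<close>
    moreover have "(1 - ?t) * (1 + V ?t) \<le> N - lift ?t"
    proof -
      have "(1 - ?t) * (1 + V ?t) \<le> (1 - ?t) * (1 + V 1)"
        using b V_mono[of ?t 1] by (intro mult_left_mono) auto
      then show ?thesis using lift_diff[of ?t 1] b unfolding lift_1 by linarith
    qed
    ultimately have "?s * (1 + V ?s) \<le> \<alpha>" "(1 - ?t) * (1 + V ?t) \<le> \<beta>"
      by (auto simp: lift_def)
    then have "?s \<le> \<alpha> / (1 + V ?s)" "1 - ?t \<le> \<beta> / (1 + V ?t)"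
      using Vu Vv by (auto simp: pos_le_divide_eq)
    then show ?thesis
      using \<alpha> \<beta> Vu Vv b unfolding splits_def duv
      by (auto simp: dist_circle_alt coord_circle_of)
  qed
qed

text \<open>Equal to \<open>exp\<close> of minus the Birkhoff sum of \<open>ln (1 + V)\<close>, the
  extra factor in the operator behind \<open>theta\<close>.\<close>

definition contraction :: "nat \<Rightarrow> circle \<Rightarrow> real" where
  "contraction n u = (\<Prod>k<n. 1 / (1 + V (coord ((T ^^ k) u))))"

lemma contraction_nonneg: "0 \<le> contraction n u"
  unfolding contraction_def using V_nonneg coord_bounds by (intro prod_nonneg) simp

lemma splits_pullback_iterate:
  assumes "\<And>k. k < n \<Longrightarrow> dist ((T ^^ k) u) ((T ^^ k) v) < \<rho>"
    and "splits ((T ^^ n) u) ((T ^^ n) v) \<alpha> \<beta>"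
  shows "splits u v (contraction n u * \<alpha>) (contraction n v * \<beta>)"
  using assms
proof (induction n arbitrary: \<alpha> \<beta>)
  case 0
  then show ?case by (simp add: contraction_def)
next
  case (Suc n)
  have "splits ((T ^^ n) u) ((T ^^ n) v)
      (\<alpha> / (1 + V (coord ((T ^^ n) u)))) (\<beta> / (1 + V (coord ((T ^^ n) v))))"
    using Suc.prems by (intro splits_pullback) auto
  from Suc.IH[OF _ this] Suc.prems(1) show ?case by (simp add: contraction_def)
qed

section \<open>Iterated transfer operators as sums over preimages\<close>

definition preimages :: "nat \<Rightarrow> circle \<Rightarrow> circle set" where
  "preimages n x = (T ^^ n) -` {x}"

definition birkhoff :: "(circle \<Rightarrow> real) \<Rightarrow> nat \<Rightarrow> circle \<Rightarrow> real" where
  "birkhoff g n u = (\<Sum>k<n. g ((T ^^ k) u))"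

lemma preimages_Suc: "preimages (Suc n) x = (\<Union>u\<in>T -` {x}. preimages n u)"
  by (auto simp: preimages_def)

lemma finite_preimages: "finite (preimages n x)"
proof (induction n arbitrary: x)
  case 0
  then show ?case by (simp add: preimages_def vimage_def)
next
  case (Suc n)
  then show ?case using finite_preimage by (simp add: preimages_Suc)
qed

lemma transfer_iterate:
  "(transfer V g ^^ n) \<phi> x = (\<Sum>u\<in>preimages n x. exp (birkhoff g n u) * \<phi> u)"
proof (induction n arbitrary: x)
  case 0
  then show ?case by (simp add: preimages_def birkhoff_def vimage_def)
next
  case (Suc n)
  have "(transfer V g ^^ Suc n) \<phi> x
      = (\<Sum>u\<in>T -` {x}. exp (g u) * (\<Sum>w\<in>preimages n u. exp (birkhoff g n w) * \<phi> w))"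
    by (simp add: transfer_def Suc)
  \<comment> \<open>For \<open>w\<close> over \<open>u\<close>, the last term of the longer Birkhoff
    sum is \<open>g ((T ^^ n) w) = g u\<close>.\<close>
  also have "\<dots> = (\<Sum>u\<in>T -` {x}. \<Sum>w\<in>preimages n u. exp (birkhoff g (Suc n) w) * \<phi> w)"
    unfolding sum_distrib_left
    by (intro sum.cong) (auto simp: preimages_def birkhoff_def exp_add)
  also have "\<dots> = (\<Sum>w\<in>preimages (Suc n) x. exp (birkhoff g (Suc n) w) * \<phi> w)"
    unfolding preimages_Suc
    by (rule sum.UNION_disjoint[symmetric])
      (auto simp: finite_preimage finite_preimages, auto simp: preimages_def)
  finally show ?case .
qed

section \<open>Preorbits and finite-step preimages\<close>

lemma preorbit_iterate:
  assumes "s \<in> preorbits V x" "k \<le> n"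
  shows "(T ^^ (n - k)) (s n) = s k"
  using assms(2)
proof (induction n rule: dec_induct)
  case base
  show ?case by simp
next
  case (step n)
  have "(T ^^ (Suc n - k)) (s (Suc n)) = (T ^^ (n - k)) (T (s (Suc n)))"
    using step(1) by (simp add: Suc_diff_le funpow_swap1)
  then show ?case using assms(1) step by (simp add: preorbits_def)
qed

lemma preorbit_end_in_preimages:
  "s \<in> preorbits V x \<Longrightarrow> s n \<in> preimages n x"
  using preorbit_iterate[of s x 0 n] by (simp add: preimages_def) (simp add: preorbits_def)

lemma ex_preorbit:
  assumes "u \<in> preimages n x"
  shows "\<exists>s\<in>preorbits V x. s n = u"
proof -
  obtain R where R: "\<And>u. T (R u) = u" using T_surj by metis
  \<comment> \<open>Up to index \<open>n\<close> the forward orbit of \<open>u\<close> is read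
    backwards; beyond it, a right inverse of \<open>T\<close> continues the preorbit.\<close>
  define s where "s k = (if k \<le> n then (T ^^ (n - k)) u else (R ^^ (k - n)) u)" for k
  have "T (s (Suc k)) = s k" for k
  proof -
    consider "k < n" | "k = n" | "n < k" by linarith
    then show ?thesis
    proof cases
      case 1
      then have "n - k = Suc (n - Suc k)" by simp
      with 1 show ?thesis by (simp add: s_def)
    qed (auto simp: s_def R Suc_diff_le)
  qed
  then have "s \<in> preorbits V x" using assms by (simp add: preorbits_def s_def preimages_def)
  moreover have "s n = u" by (simp add: s_def)
  ultimately show ?thesis by blast
qed

text \<open>Both preorbits start at \<open>y\<close>, and at each further index
  \<open>preimage_unique\<close> leaves one choice within \<open>\<rho>\<close> of the shadowed
  point. Agreement up to \<open>n\<close> therefore depends only on the shadowed points up to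
  \<open>n\<close>.\<close>

lemma shadowing_unique:
  assumes "t \<in> preorbits V y" "t' \<in> preorbits V y"
    and "\<And>k. dist (s k) (t k) < \<rho>" "\<And>k. dist (s' k) (t' k) < \<rho>"
    and "\<And>k. k \<le> n \<Longrightarrow> s k = s' k"
    and "k \<le> n"
  shows "t k = t' k"
  using assms(6)
proof (induction k)
  case 0
  then show ?case using assms(1,2) by (simp add: preorbits_def)
next
  case (Suc k)
  show ?case
  proof (rule preimage_unique)
    show "dist (s (Suc k)) (t (Suc k)) < \<rho>" by fact
    show "dist (s (Suc k)) (t' (Suc k)) < \<rho>" using assms(4)[of "Suc k"] assms(5)[of "Suc k"] Suc by simp
    show "T (t (Suc k)) = T (t' (Suc k))" using assms(1,2) Suc by (simp add: preorbits_def)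
  qed
qed

end

section \<open>The pairing of finite-step preimages\<close>

locale RPF_circle_dynamics = circle_dynamics +
  fixes \<omega> \<Omega> :: "real \<Rightarrow> real" and r C :: real
    and f :: "circle \<Rightarrow> real" and eig :: real and h :: "circle \<Rightarrow> real" and \<nu> :: "circle measure"
  assumes mod_\<omega>: "modulus_of_continuity \<omega>" and mod_\<Omega>: "modulus_of_continuity \<Omega>"
    and compat: "T_compatible V \<omega> \<Omega> r C" and r_less: "r < \<rho>"
    and concave: "concave_on {0..} \<Omega>"
    and f: "f \<in> C_mod \<omega>" and RPF: "RPF_triple V \<Omega> f eig h \<nu>"
begin

lemma r_pos: "0 < r" and C_pos: "0 < C" and r_less_half: "r < 1/2"
  using compat r_less radius by (auto simp: T_compatible_def admissible_radius_def)

lemma eig_pos: "0 < eig" and h_pos: "0 < h x"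
  using RPF by (auto simp: RPF_triple_def)

abbreviation \<kappa> :: real where "\<kappa> \<equiv> kappa \<omega> C f"

lemma \<kappa>_nonneg: "0 \<le> \<kappa>"
  using mod_seminorm_nonneg[OF mod_\<omega> f] C_pos by (simp add: kappa_def)

text \<open>Each \<open>n\<close>-step preimage is extended to a chosen preorbit, which is sent
  through the bijection of compatibility and cut off at index \<open>n\<close>. Shadowing
  uniqueness, used in both directions, makes the result a bijection.\<close>

lemma preimage_pairing:
  assumes xy: "dist x y < r"
  obtains b where "bij_betw b (preimages n x) (preimages n y)"
    "\<And>u k. u \<in> preimages n x \<Longrightarrow> k \<le> n \<Longrightarrow> dist ((T ^^ k) u) ((T ^^ k) (b u)) \<le> dist x y"
    "\<And>u. u \<in> preimages n x \<Longrightarrow>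
       C * (\<Sum>k<n. \<omega> (dist ((T ^^ k) u) ((T ^^ k) (b u)))) \<le> \<Omega> (dist x y) - \<Omega> (dist u (b u))"
proof -
  obtain B where B: "bij_betw B (preorbits V x) (preorbits V y)"
    and Bd: "\<And>s k. s \<in> preorbits V x \<Longrightarrow> dist (s k) (B s k) \<le> dist x y"
    and BC: "\<And>s k. s \<in> preorbits V x \<Longrightarrow>
      C * (\<Sum>j=1..k. \<omega> (dist (s j) (B s j))) \<le> \<Omega> (dist x y) - \<Omega> (dist (s k) (B s k))"
    using compat xy unfolding T_compatible_def by meson
  have Bmem: "B s \<in> preorbits V y" if "s \<in> preorbits V x" for s
    using B that by (auto simp: bij_betw_def)
  have close: "dist (s k) (B s k) < \<rho>" "dist (B s k) (s k) < \<rho>" if "s \<in> preorbits V x" for s k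
    using Bd[OF that, of k] xy r_less by (auto simp: dist_commute)
  define e where "e u = (SOME s. s \<in> preorbits V x \<and> s n = u)" for u
  have e: "e u \<in> preorbits V x" "e u n = u" if "u \<in> preimages n x" for u
    using someI_ex[of "\<lambda>s. s \<in> preorbits V x \<and> s n = u"] ex_preorbit[OF that] unfolding e_def by auto
  have determined: "s k = s' k"
    if "s \<in> preorbits V z" "s' \<in> preorbits V z" "s n = s' n" "k \<le> n" for s s' z k
    using that preorbit_iterate by metis
  define b where "b u = B (e u) n" for u
  show thesis
  proof
    show "bij_betw b (preimages n x) (preimages n y)"
    proof (rule bij_betwI')
      fix u u' assume u: "u \<in> preimages n x" and u': "u' \<in> preimages n x"
      show "(b u = b u') = (u = u')"
      proof
        assume "b u = b u'"
        \<comment> \<open>Here the roles are exchanged: the preorbits of \<open>x\<close> shadow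
          their images.\<close>
        then have "B (e u) k = B (e u') k" if "k \<le> n" for k
          using determined[OF Bmem[OF e(1)[OF u]] Bmem[OF e(1)[OF u']] _ that] by (simp add: b_def)
        then have "e u n = e u' n"
          by (intro shadowing_unique[OF e(1)[OF u] e(1)[OF u'], of "B (e u)" "B (e u')" n] close e u u') auto
        then show "u = u'" by (simp add: e u u')
      qed simp
    next
      fix u assume "u \<in> preimages n x"
      then show "b u \<in> preimages n y"
        by (simp add: b_def preorbit_end_in_preimages[OF Bmem] e)
    next
      fix v assume "v \<in> preimages n y"
      then obtain t where t: "t \<in> preorbits V y" "t n = v" using ex_preorbit by blast
      then obtain s where s: "s \<in> preorbits V x" "B s = t"
        using bij_betw_imp_surj_on[OF B] by (metis imageE)
      define u where "u = s n"
      have u: "u \<in> preimages n x" unfolding u_def by (rule preorbit_end_in_preimages[OF s(1)])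
      \<comment> \<open>The chosen extension of \<open>u\<close> may differ from \<open>s\<close>
        beyond \<open>n\<close>, but both agree up to \<open>n\<close>, hence so do their
        images.\<close>
      have "e u k = s k" if "k \<le> n" for k
        using determined[OF e(1)[OF u] s(1) _ that] e(2)[OF u] by (simp add: u_def)
      then have "B (e u) n = B s n"
        by (intro shadowing_unique[OF Bmem[OF e(1)[OF u]] Bmem[OF s(1)], of "e u" s n] close e u s) auto
      then show "\<exists>u\<in>preimages n x. v = b u" using u s t by (auto simp: b_def)
    qed
  next
    fix u k assume u: "u \<in> preimages n x" and k: "k \<le> n"
    have T_s: "(T ^^ k) u = e u (n - k)"
      using preorbit_iterate[OF e(1)[OF u], of "n - k" n] e(2)[OF u] k by simp
    have T_B: "(T ^^ k) (b u) = B (e u) (n - k)"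
      using preorbit_iterate[OF Bmem[OF e(1)[OF u]], of "n - k" n] k by (simp add: b_def)
    show "dist ((T ^^ k) u) ((T ^^ k) (b u)) \<le> dist x y"
      unfolding T_s T_B by (rule Bd[OF e(1)[OF u]])
  next
    fix u assume u: "u \<in> preimages n x"
    have T_s: "(T ^^ k) u = e u (n - k)" if "k \<le> n" for k
      using preorbit_iterate[OF e(1)[OF u], of "n - k" n] e(2)[OF u] that by simp
    have T_B: "(T ^^ k) (b u) = B (e u) (n - k)" if "k \<le> n" for k
      using preorbit_iterate[OF Bmem[OF e(1)[OF u]], of "n - k" n] that by (simp add: b_def)
    \<comment> \<open>Time reversal \<open>j = n - k\<close>: forward times 0 to
      \<open>n - 1\<close> are the indices \<open>n\<close> down to 1, so the base pair
      \<open>x\<close>, \<open>y\<close> is left out on both sides.\<close>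
    have "(\<Sum>k<n. \<omega> (dist ((T ^^ k) u) ((T ^^ k) (b u)))) = (\<Sum>j=1..n. \<omega> (dist (e u j) (B (e u) j)))"
      by (rule sum.reindex_bij_witness[of _ "\<lambda>j. n - j" "\<lambda>k. n - k"]) (auto simp: T_s T_B)
    then show "C * (\<Sum>k<n. \<omega> (dist ((T ^^ k) u) ((T ^^ k) (b u)))) \<le> \<Omega> (dist x y) - \<Omega> (dist u (b u))"
      using BC[OF e(1)[OF u], of n] by (simp add: e u b_def)
  qed
qed

section \<open>Distortion and bounds for the eigenfunction\<close>

lemma birkhoff_distortion:
  assumes "C * (\<Sum>k<n. \<omega> (dist ((T ^^ k) u) ((T ^^ k) v))) \<le> D"
  shows "\<bar>birkhoff f n u - birkhoff f n v\<bar> \<le> \<kappa> * D"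
proof -
  have "\<bar>birkhoff f n u - birkhoff f n v\<bar> \<le> (\<Sum>k<n. \<bar>f ((T ^^ k) u) - f ((T ^^ k) v)\<bar>)"
    unfolding birkhoff_def by (simp flip: sum_subtractf)
  also have "\<dots> \<le> (\<Sum>k<n. mod_seminorm \<omega> f * \<omega> (dist ((T ^^ k) u) ((T ^^ k) v)))"
    by (intro sum_mono mod_seminorm_bound mod_\<omega> f)
  also have "\<dots> = \<kappa> * (C * (\<Sum>k<n. \<omega> (dist ((T ^^ k) u) ((T ^^ k) v))))"
    using C_pos by (simp add: kappa_def sum_distrib_left)
  also have "\<dots> \<le> \<kappa> * D"
    using assms \<kappa>_nonneg by (rule mult_left_mono)
  finally show ?thesis .
qed

text \<open>The convergence clause for the constant function 1, whose integral is 1.\<close>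

lemma h_limit: "(\<lambda>n. (transfer V f ^^ n) (\<lambda>_. 1) x / eig ^ n) \<longlonglongrightarrow> h x"
proof -
  have "prob_space \<nu>"
    using RPF unfolding RPF_triple_def by (elim conjE)
  then have int: "(\<integral>x. 1 \<partial>\<nu>) = (1::real)"
    by (simp add: prob_space.prob_space)
  have "\<forall>\<psi>. continuous_on UNIV \<psi> \<longrightarrow>
      uniform_limit UNIV (\<lambda>n x. (transfer V f ^^ n) \<psi> x / eig ^ n)
        (\<lambda>x. h x * (\<integral>y. \<psi> y \<partial>\<nu>)) sequentially"
    using RPF unfolding RPF_triple_def by (elim conjE)
  from this[THEN spec, of "\<lambda>_. 1", THEN mp, OF continuous_on_const]
  have "(\<lambda>n. (transfer V f ^^ n) (\<lambda>_. 1) x / eig ^ n) \<longlonglongrightarrow> h x * (\<integral>y. 1 \<partial>\<nu>)"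
    by (rule tendsto_uniform_limitI) (rule UNIV_I)
  then show ?thesis unfolding int by (simp only: mult_1_right)
qed

text \<open>The terms of the \<open>n\<close>-step sums at \<open>x\<close> and \<open>y\<close> are
  paired and compared one by one. The factor does not depend on \<open>n\<close>, so the bound
  passes to the limit \<open>h\<close>.\<close>

lemma h_ratio:
  assumes xy: "dist x y < r"
  shows "h x \<le> exp (\<kappa> * \<Omega> (dist x y)) * h y"
proof (rule LIMSEQ_le[OF h_limit tendsto_mult_left[OF h_limit]], intro exI allI impI)
  fix n :: nat
  obtain b where b: "bij_betw b (preimages n x) (preimages n y)"
    and bC: "\<And>u. u \<in> preimages n x \<Longrightarrow>
       C * (\<Sum>k<n. \<omega> (dist ((T ^^ k) u) ((T ^^ k) (b u)))) \<le> \<Omega> (dist x y) - \<Omega> (dist u (b u))"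
    using preimage_pairing[OF xy] by metis
  have "(transfer V f ^^ n) (\<lambda>_. 1) x = (\<Sum>u\<in>preimages n x. exp (birkhoff f n u))"
    by (simp add: transfer_iterate)
  also have "\<dots> \<le> (\<Sum>u\<in>preimages n x. exp (\<kappa> * \<Omega> (dist x y)) * exp (birkhoff f n (b u)))"
  proof (rule sum_mono)
    fix u assume "u \<in> preimages n x"
    then have "C * (\<Sum>k<n. \<omega> (dist ((T ^^ k) u) ((T ^^ k) (b u)))) \<le> \<Omega> (dist x y)"
      using bC[of u] modulus_nonneg[OF mod_\<Omega>, of "dist u (b u)"] by simp
    from birkhoff_distortion[OF this]
    show "exp (birkhoff f n u) \<le> exp (\<kappa> * \<Omega> (dist x y)) * exp (birkhoff f n (b u))"
      by (simp flip: exp_add)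
  qed
  also have "\<dots> = exp (\<kappa> * \<Omega> (dist x y)) * (\<Sum>v\<in>preimages n y. exp (birkhoff f n v))"
    using sum.reindex_bij_betw[OF b, of "\<lambda>v. exp (birkhoff f n v)"] by (simp flip: sum_distrib_left)
  also have "\<dots> = exp (\<kappa> * \<Omega> (dist x y)) * (transfer V f ^^ n) (\<lambda>_. 1) y"
    by (simp add: transfer_iterate)
  finally show "(transfer V f ^^ n) (\<lambda>_. 1) x / eig ^ n
      \<le> exp (\<kappa> * \<Omega> (dist x y)) * ((transfer V f ^^ n) (\<lambda>_. 1) y / eig ^ n)"
    using eig_pos by (simp add: divide_right_mono)
qed

text \<open>As the diameter is \<open>1/2\<close>, the hypothesis on \<open>M\<close> makes each of
  \<open>M\<close> equal steps shorter than \<open>r\<close>.\<close>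

lemma chain_step:
  fixes x y :: circle
  assumes "1 / r < 2 * real M"
  shows "dist x y / real M < r" "dist x y / real M \<le> dist x y" "0 < M"
proof -
  show M: "0 < M" using assms r_pos by (intro gr0I) (auto simp: field_simps)
  then have "dist x y / real M \<le> (1/2) / real M"
    using dist_circle_le_half[of x y] by (intro divide_right_mono) auto
  also have "\<dots> < r" using assms r_pos M by (simp add: field_simps)
  finally show "dist x y / real M < r" .
  show "dist x y / real M \<le> dist x y"
    using M by (simp add: divide_le_eq mult_le_cancel_left1)
qed

text \<open>Chaining \<open>h_ratio\<close> over \<open>M\<close> short steps compares
  \<open>h\<close> at any two points up to a fixed factor. This bounds \<open>h\<close> above and
  keeps its infimum positive.\<close>

lemma h_bounds:
  shows "bdd_above (range h)" "bdd_below (range h)" "0 < (INF x. h x)"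
    "h x \<le> (SUP x. h x)" "(INF x. h x) \<le> h x"
proof -
  obtain M :: nat where "1 / r / 2 < real M" using reals_Archimedean2 by blast
  then have M: "1 / r < 2 * real M" by simp
  define E where "E = exp (\<kappa> * \<Omega> (1/2))"
  have E: "h x \<le> E ^ M * h y" for x y
  proof -
    obtain z where z: "z 0 = x" "z M = y" "\<And>k. dist (z k) (z (Suc k)) \<le> dist x y / real M"
      using circle_chain[OF chain_step(3)[OF M]] by metis
    have "h x \<le> E ^ k * h (z k)" for k
    proof (induction k)
      case (Suc k)
      have "dist (z k) (z (Suc k)) < r" using z(3)[of k] chain_step(1)[OF M, of x y] by linarith
      then have "h (z k) \<le> exp (\<kappa> * \<Omega> (dist (z k) (z (Suc k)))) * h (z (Suc k))" by (rule h_ratio)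
      also have "\<dots> \<le> E * h (z (Suc k))"
        using h_pos[of "z (Suc k)"] \<kappa>_nonneg modulus_mono[OF mod_\<Omega>] dist_circle_le_half
        unfolding E_def by (intro mult_right_mono) (auto intro!: mult_left_mono)
      finally have "E ^ k * h (z k) \<le> E ^ k * (E * h (z (Suc k)))"
        by (intro mult_left_mono) (auto simp: E_def)
      with Suc show ?case by (simp add: mult_ac)
    qed (simp add: z)
    from this[of M] show ?thesis by (simp add: z)
  qed
  show above: "bdd_above (range h)"
    using E[of _ undefined] by (intro bdd_aboveI2)
  show below: "bdd_below (range h)"
    using h_pos by (intro bdd_belowI2[of _ 0]) (auto intro: less_imp_le)
  have "0 < h undefined / E ^ M" using h_pos by (simp add: E_def)
  also have "\<dots> \<le> (INF x. h x)"
    using E[of undefined] by (intro cINF_greatest) (auto simp: E_def divide_le_eq mult.commute)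
  finally show "0 < (INF x. h x)" .
  show "h x \<le> (SUP x. h x)" "(INF x. h x) \<le> h x"
    using above below by (auto intro: cSUP_upper cINF_lower)
qed

section \<open>The weights of the normalized operator\<close>

abbreviation Q :: real where "Q \<equiv> (SUP x. h x) / (INF x. h x)"

lemma h_quotient: "h x / h y \<le> Q"
  using h_bounds(3) h_bounds(4)[of x] h_bounds(5)[of y] h_pos[of x] by (intro frac_le) auto

lemma Q_ge_1: "1 \<le> Q"
  using h_quotient[of undefined undefined] h_pos[of undefined] by simp

definition weight :: "nat \<Rightarrow> circle \<Rightarrow> real" where
  "weight n u = exp (birkhoff f n u) * h u / (eig ^ n * h ((T ^^ n) u))"

lemma weight_pos: "0 < weight n u"
  using eig_pos h_pos by (simp add: weight_def)

text \<open>The terms \<open>ln h\<close> and \<open>- ln h\<close> after one step telescope along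
  the orbit, leaving \<open>h\<close> at its two ends only.\<close>

lemma exp_birkhoff_normalized: "exp (birkhoff (normalized_potential V f eig h) n u) = weight n u"
proof (induction n)
  case 0
  then show ?case using h_pos[of u] by (simp add: birkhoff_def weight_def)
next
  case (Suc n)
  have "exp (normalized_potential V f eig h ((T ^^ n) u))
      = exp (f ((T ^^ n) u)) * h ((T ^^ n) u) / (eig * h ((T ^^ Suc n) u))"
    using eig_pos h_pos by (simp add: normalized_potential_def exp_diff exp_add)
  moreover have "exp (birkhoff (normalized_potential V f eig h) (Suc n) u)
      = weight n u * exp (normalized_potential V f eig h ((T ^^ n) u))"
    using Suc by (simp add: birkhoff_def exp_add)
  ultimately show ?case
    using h_pos[of "(T ^^ n) u"] by (simp add: weight_def birkhoff_def exp_add field_simps)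
qed

lemma normalized_transfer:
  "(transfer V (normalized_potential V f eig h) ^^ n) \<phi> x = (\<Sum>u\<in>preimages n x. weight n u * \<phi> u)"
  by (simp add: transfer_iterate exp_birkhoff_normalized)

lemma transfer_h: "(transfer V f ^^ n) h x = eig ^ n * h x"
proof (induction n arbitrary: x)
  case (Suc n)
  have "(transfer V f ^^ n) h = (\<lambda>x. eig ^ n * h x)" using Suc by blast
  moreover have "transfer V f (\<lambda>x. eig ^ n * h x) x = eig ^ n * transfer V f h x"
    by (simp add: transfer_def sum_distrib_left mult_ac)
  moreover have "transfer V f h x = eig * h x" using RPF by (simp add: RPF_triple_def)
  ultimately show ?case by simp
qed simp

text \<open>The eigenvalue equation for \<open>h\<close>, iterated \<open>n\<close> times.\<close>

lemma sum_weight: "(\<Sum>u\<in>preimages n x. weight n u) = 1"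
proof -
  have "(\<Sum>u\<in>preimages n x. weight n u)
      = (\<Sum>u\<in>preimages n x. exp (birkhoff f n u) * h u) / (eig ^ n * h x)"
    unfolding sum_divide_distrib by (rule sum.cong) (auto simp: weight_def preimages_def)
  also have "\<dots> = (transfer V f ^^ n) h x / (eig ^ n * h x)" by (simp add: transfer_iterate)
  also have "\<dots> = 1" using eig_pos h_pos[of x] by (simp add: transfer_h)
  finally show ?thesis .
qed

section \<open>The averaged contraction\<close>

abbreviation \<theta> :: "nat \<Rightarrow> real" where "\<theta> \<equiv> theta V f eig"

lemma exp_birkhoff_log:
  "exp (birkhoff (\<lambda>x. f x - ln (1 + V (coord x))) n u) = exp (birkhoff f n u) * contraction n u"
proof (induction n)
  case (Suc n)
  have "0 < 1 + V (coord ((T ^^ n) u))"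
    using V_nonneg[OF coord_bounds(1)] by (simp add: add_pos_nonneg)
  then show ?case using Suc by (simp add: birkhoff_def contraction_def exp_add exp_diff)
qed (simp add: birkhoff_def contraction_def)

lemma contraction_le_1: "contraction n u \<le> 1"
  unfolding contraction_def using V_nonneg[OF coord_bounds(1)]
  by (intro prod_le_1) (auto simp: divide_le_eq)

text \<open>Guarantees that the supremum in \<open>theta\<close> is finite. The contraction is at
  most 1, and replacing the remaining terms by weights costs a quotient of values of
  \<open>h\<close>.\<close>

lemma log_transfer_bounds:
  "0 \<le> (transfer V (\<lambda>x. f x - ln (1 + V (coord x))) ^^ n) (\<lambda>_. 1) x"
  "(transfer V (\<lambda>x. f x - ln (1 + V (coord x))) ^^ n) (\<lambda>_. 1) x \<le> eig ^ n * Q"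
proof -
  show "0 \<le> (transfer V (\<lambda>x. f x - ln (1 + V (coord x))) ^^ n) (\<lambda>_. 1) x"
    unfolding transfer_iterate by (intro sum_nonneg) simp
  have "(transfer V (\<lambda>x. f x - ln (1 + V (coord x))) ^^ n) (\<lambda>_. 1) x
      = (\<Sum>u\<in>preimages n x. exp (birkhoff f n u) * contraction n u)"
    by (simp add: transfer_iterate exp_birkhoff_log)
  also have "\<dots> \<le> (\<Sum>u\<in>preimages n x. eig ^ n * Q * weight n u)"
  proof (rule sum_mono)
    fix u assume "u \<in> preimages n x"
    have "exp (birkhoff f n u) * contraction n u \<le> exp (birkhoff f n u)"
      using contraction_le_1 by (simp add: mult_le_cancel_left1)
    also have "\<dots> = eig ^ n * (h ((T ^^ n) u) / h u) * weight n u"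
      using eig_pos h_pos[of u] h_pos[of "(T ^^ n) u"] by (simp add: weight_def field_simps)
    also have "\<dots> \<le> eig ^ n * Q * weight n u"
      using eig_pos weight_pos[of n u] h_quotient
      by (intro mult_right_mono mult_left_mono) auto
    finally show "exp (birkhoff f n u) * contraction n u \<le> eig ^ n * Q * weight n u" .
  qed
  also have "\<dots> = eig ^ n * Q" by (simp only: sum_weight mult_1_right flip: sum_distrib_left)
  finally show "(transfer V (\<lambda>x. f x - ln (1 + V (coord x))) ^^ n) (\<lambda>_. 1) x \<le> eig ^ n * Q" .
qed

lemma log_transfer_le_\<theta>:
  "(transfer V (\<lambda>x. f x - ln (1 + V (coord x))) ^^ n) (\<lambda>_. 1) x \<le> eig ^ n * \<theta> n"
proof -
  have "bdd_above (range (\<lambda>x. \<bar>(transfer V (\<lambda>x. f x - ln (1 + V (coord x))) ^^ n) (\<lambda>_. 1) x\<bar>))"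
    using log_transfer_bounds by (intro bdd_aboveI2[where M = "eig ^ n * Q"]) (metis abs_of_nonneg)
  then have "\<bar>(transfer V (\<lambda>x. f x - ln (1 + V (coord x))) ^^ n) (\<lambda>_. 1) x\<bar>
      \<le> sup_norm ((transfer V (\<lambda>x. f x - ln (1 + V (coord x))) ^^ n) (\<lambda>_. 1))"
    unfolding sup_norm_def by (intro cSUP_upper) auto
  then show ?thesis using eig_pos by (simp add: theta_def)
qed

lemma \<theta>_nonneg: "0 \<le> \<theta> n"
  using order_trans[OF log_transfer_bounds(1) log_transfer_le_\<theta>, of n]
    zero_less_power[OF eig_pos, of n] by (simp add: zero_le_mult_iff)

text \<open>Up to the power of \<open>eig\<close>, the terms differ from those in
  \<open>theta\<close> only by \<open>h u / h ((T ^^ n) u) \<le> Q\<close>.\<close>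

lemma sum_weight_contraction: "(\<Sum>u\<in>preimages n x. weight n u * contraction n u) \<le> Q * \<theta> n"
proof -
  have "(\<Sum>u\<in>preimages n x. weight n u * contraction n u)
      \<le> (\<Sum>u\<in>preimages n x. Q / eig ^ n * (exp (birkhoff f n u) * contraction n u))"
  proof (rule sum_mono)
    fix u
    have "weight n u * contraction n u
        = (h u / h ((T ^^ n) u)) * (exp (birkhoff f n u) * contraction n u / eig ^ n)"
      by (simp add: weight_def mult_ac)
    also have "\<dots> \<le> Q * (exp (birkhoff f n u) * contraction n u / eig ^ n)"
      using eig_pos contraction_nonneg by (intro mult_right_mono h_quotient) simp
    finally show "weight n u * contraction n u
        \<le> Q / eig ^ n * (exp (birkhoff f n u) * contraction n u)" by simp
  qed
  also have "\<dots> = Q / eig ^ n * (transfer V (\<lambda>x. f x - ln (1 + V (coord x))) ^^ n) (\<lambda>_. 1) x"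
    by (simp add: transfer_iterate exp_birkhoff_log sum_distrib_left)
  also have "\<dots> \<le> Q / eig ^ n * (eig ^ n * \<theta> n)"
    using eig_pos Q_ge_1 by (intro mult_left_mono log_transfer_le_\<theta> divide_nonneg_nonneg[of Q]) auto
  also have "\<dots> = Q * \<theta> n" using eig_pos by simp
  finally show ?thesis .
qed

section \<open>The local estimate\<close>

abbreviation \<Gamma> :: real where "\<Gamma> \<equiv> Gamma_const \<omega> \<Omega> C f h"

lemma \<Gamma>_ge: "2 * \<kappa> * exp (2 * \<kappa> * \<Omega> (1/2)) \<le> \<Gamma>" "Q \<le> \<Gamma>"
  by (auto simp: Gamma_const_def le_max_iff_disj)

text \<open>One \<open>\<kappa> * \<Omega> (dist x y)\<close> comes from the Birkhoff sums together
  with \<open>h\<close> at \<open>u\<close> and \<open>v\<close>, where the terms in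
  \<open>\<Omega> (dist u v)\<close> cancel; the other comes from \<open>h\<close> at
  \<open>x\<close> and \<open>y\<close>.\<close>

lemma weight_distortion:
  assumes xy: "dist x y < r" and u: "(T ^^ n) u = x" and v: "(T ^^ n) v = y"
    and uv: "dist u v \<le> dist x y"
    and C: "C * (\<Sum>k<n. \<omega> (dist ((T ^^ k) u) ((T ^^ k) v))) \<le> \<Omega> (dist x y) - \<Omega> (dist u v)"
  shows "weight n u \<le> exp (2 * \<kappa> * \<Omega> (dist x y)) * weight n v"
proof -
  have "exp (birkhoff f n u) \<le> exp (\<kappa> * (\<Omega> (dist x y) - \<Omega> (dist u v))) * exp (birkhoff f n v)"
    using birkhoff_distortion[OF C] by (simp flip: exp_add)
  moreover have "h u \<le> exp (\<kappa> * \<Omega> (dist u v)) * h v"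
    using h_ratio[of u v] uv xy by simp
  ultimately have "exp (birkhoff f n u) * h u
      \<le> (exp (\<kappa> * (\<Omega> (dist x y) - \<Omega> (dist u v))) * exp (birkhoff f n v)) * (exp (\<kappa> * \<Omega> (dist u v)) * h v)"
    using h_pos[of u] by (intro mult_mono) auto
  also have "\<dots> = exp (\<kappa> * \<Omega> (dist x y)) * (exp (birkhoff f n v) * h v)"
    by (simp add: right_diff_distrib exp_diff)
  finally have 1: "exp (birkhoff f n u) * h u \<le> exp (\<kappa> * \<Omega> (dist x y)) * (exp (birkhoff f n v) * h v)" .
  have "h y \<le> exp (\<kappa> * \<Omega> (dist x y)) * h x"
    using h_ratio[of y x] xy by (simp add: dist_commute)
  then have "1 / h x \<le> exp (\<kappa> * \<Omega> (dist x y)) * (1 / h y)"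
    using h_pos[of x] h_pos[of y] by (simp add: field_simps)
  then have "(exp (birkhoff f n u) * h u) * (1 / h x)
      \<le> (exp (\<kappa> * \<Omega> (dist x y)) * (exp (birkhoff f n v) * h v)) * (exp (\<kappa> * \<Omega> (dist x y)) * (1 / h y))"
    by (intro mult_mono[OF 1]) (use h_pos in \<open>auto intro: less_imp_le\<close>)
  also have "\<dots> = exp (2 * \<kappa> * \<Omega> (dist x y)) * (exp (birkhoff f n v) * h v * (1 / h y))"
    by (simp add: mult_exp_exp)
  finally have "exp (birkhoff f n u) * h u / h x / eig ^ n
      \<le> exp (2 * \<kappa> * \<Omega> (dist x y)) * (exp (birkhoff f n v) * h v * (1 / h y)) / eig ^ n"
    using eig_pos by (intro divide_right_mono) auto
  then show ?thesis by (simp add: weight_def u v mult.commute)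
qed

lemma normalized_transfer_diff_le:
  assumes xy: "dist x y < r" and \<phi>: "\<phi> \<in> C_mod \<Omega>"
  shows "\<bar>(transfer V (normalized_potential V f eig h) ^^ n) \<phi> x
      - (transfer V (normalized_potential V f eig h) ^^ n) \<phi> y\<bar>
    \<le> \<Gamma> * (mod_seminorm \<Omega> \<phi> * \<Omega> (\<theta> n * dist x y) + sup_norm \<phi> * \<Omega> (dist x y))"
proof -
  let ?P = "preimages n x" and ?D = "dist x y" and ?A = "mod_seminorm \<Omega> \<phi>" and ?S = "sup_norm \<phi>"
  obtain b where b: "bij_betw b ?P (preimages n y)"
    and bd: "\<And>u k. u \<in> ?P \<Longrightarrow> k \<le> n \<Longrightarrow> dist ((T ^^ k) u) ((T ^^ k) (b u)) \<le> ?D"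
    and bC: "\<And>u. u \<in> ?P \<Longrightarrow>
       C * (\<Sum>k<n. \<omega> (dist ((T ^^ k) u) ((T ^^ k) (b u)))) \<le> \<Omega> ?D - \<Omega> (dist u (b u))"
    by (rule preimage_pairing[OF xy, of n]) blast
  have Tu: "(T ^^ n) u = x" if "u \<in> ?P" for u using that by (simp add: preimages_def)
  have Tb: "(T ^^ n) (b u) = y" if "u \<in> ?P" for u
    using bij_betwE[OF b] that by (simp add: preimages_def)
  have bd0: "dist u (b u) \<le> ?D" if "u \<in> ?P" for u using bd[OF that, of 0] by simp
  have sum_b: "(\<Sum>u\<in>?P. g (b u)) = sum g (preimages n y)" for g :: "circle \<Rightarrow> real"
    by (rule sum.reindex_bij_betw[OF b])
  define m where "m u = min (weight n u) (weight n (b u))" for u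
  have m_nonneg: "0 \<le> m u" for u using weight_pos by (simp add: m_def less_imp_le)
  have A: "0 \<le> ?A" by (rule mod_seminorm_nonneg[OF mod_\<Omega> \<phi>])
  have S: "\<bar>\<phi> u\<bar> \<le> ?S" for u by (rule abs_le_sup_norm[OF mod_\<Omega> \<phi>])
  have S0: "0 \<le> ?S" using S[of undefined] by linarith
  have \<theta>D: "0 \<le> \<theta> n * ?D" using \<theta>_nonneg by simp

  \<comment> \<open>Jensen's inequality, with the weights over \<open>x\<close> as the dominating
    probability.\<close>
  have "(\<Sum>u\<in>?P. m u * \<Omega> (dist u (b u))) \<le> \<Omega> (\<Sum>u\<in>?P. m u * dist u (b u))"
    using finite_preimages sum_weight[of n x] weight_pos m_nonneg
    by (intro concave_modulus_sum[where p = "weight n"] mod_\<Omega> concave) (auto simp: m_def)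
  also have "\<dots> \<le> \<Omega> (Q * (\<theta> n * ?D))"
  proof (rule modulus_mono[OF mod_\<Omega>])
    show "0 \<le> (\<Sum>u\<in>?P. m u * dist u (b u))" using m_nonneg by (intro sum_nonneg) simp
    obtain \<alpha> \<beta> where \<alpha>\<beta>: "splits x y \<alpha> \<beta>" "\<alpha> + \<beta> = ?D" using ex_splits by blast
    then have \<alpha>: "0 \<le> \<alpha>" and \<beta>: "0 \<le> \<beta>" by (auto simp: splits_def)
    have "(\<Sum>u\<in>?P. m u * dist u (b u))
        \<le> (\<Sum>u\<in>?P. weight n u * contraction n u * \<alpha> + weight n (b u) * contraction n (b u) * \<beta>)"
    proof (rule sum_mono)
      fix u assume u: "u \<in> ?P"
      have "splits u (b u) (contraction n u * \<alpha>) (contraction n (b u) * \<beta>)"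
      proof (rule splits_pullback_iterate)
        show "dist ((T ^^ k) u) ((T ^^ k) (b u)) < \<rho>" if "k < n" for k
          using bd[OF u less_imp_le[OF that]] xy r_less by linarith
        show "splits ((T ^^ n) u) ((T ^^ n) (b u)) \<alpha> \<beta>"
          by (simp only: Tu[OF u] Tb[OF u] \<alpha>\<beta>(1))
      qed
      then have "m u * dist u (b u) \<le> m u * (contraction n u * \<alpha>) + m u * (contraction n (b u) * \<beta>)"
        using m_nonneg[of u] unfolding splits_def by (metis distrib_left mult_left_mono)
      \<comment> \<open>The minimum is bounded by a different weight in each summand, so that each
        half arc meets the weight of its own endpoint.\<close>
      also have "\<dots> \<le> weight n u * (contraction n u * \<alpha>) + weight n (b u) * (contraction n (b u) * \<beta>)"
        using \<alpha> \<beta> contraction_nonneg by (intro add_mono mult_right_mono) (auto simp: m_def)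
      finally show "m u * dist u (b u)
          \<le> weight n u * contraction n u * \<alpha> + weight n (b u) * contraction n (b u) * \<beta>" by simp
    qed
    also have "\<dots> = (\<Sum>u\<in>?P. weight n u * contraction n u) * \<alpha>
        + (\<Sum>v\<in>preimages n y. weight n v * contraction n v) * \<beta>"
      using sum_b[of "\<lambda>v. weight n v * contraction n v"]
      by (simp add: sum.distrib flip: sum_distrib_right)
    also have "\<dots> \<le> (Q * \<theta> n) * \<alpha> + (Q * \<theta> n) * \<beta>"
      using \<alpha> \<beta> by (intro add_mono mult_right_mono sum_weight_contraction)
    also have "\<dots> = Q * (\<theta> n * ?D)" by (simp add: algebra_simps flip: \<alpha>\<beta>(2) add_divide_distrib)
    finally show "(\<Sum>u\<in>?P. m u * dist u (b u)) \<le> Q * (\<theta> n * ?D)" .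
  qed
  \<comment> \<open>Concavity takes \<open>Q \<ge> 1\<close> out of \<open>\<Omega>\<close>, which
    is where the quotient of \<open>h\<close> in \<open>Gamma_const\<close> originates.\<close>
  also have "\<dots> \<le> Q * \<Omega> (\<theta> n * ?D)"
    by (rule concave_modulus_le_mult[OF mod_\<Omega> concave Q_ge_1 \<theta>D])
  also have "\<dots> \<le> \<Gamma> * \<Omega> (\<theta> n * ?D)"
    using \<Gamma>_ge(2) modulus_nonneg[OF mod_\<Omega> \<theta>D] by (rule mult_right_mono)
  finally have close_part: "(\<Sum>u\<in>?P. m u * \<Omega> (dist u (b u))) \<le> \<Gamma> * \<Omega> (\<theta> n * ?D)" .

  define c where "c = 2 * \<kappa> * \<Omega> ?D"
  have c: "0 \<le> c" using \<kappa>_nonneg modulus_nonneg[OF mod_\<Omega>, of ?D] by (simp add: c_def)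
  have "(\<Sum>u\<in>?P. \<bar>weight n u - weight n (b u)\<bar>) \<le> (\<Sum>u\<in>?P. c * exp c * weight n (b u))"
  proof (rule sum_mono)
    fix u assume u: "u \<in> ?P"
    have "weight n u \<le> exp c * weight n (b u)"
      unfolding c_def by (rule weight_distortion[OF xy Tu[OF u] Tb[OF u] bd0[OF u] bC[OF u]])
    moreover have "weight n (b u) \<le> exp c * weight n u"
      using weight_distortion[of y x n "b u" u] xy Tu[OF u] Tb[OF u] bd0[OF u] bC[OF u]
      by (simp add: c_def dist_commute)
    ultimately show "\<bar>weight n u - weight n (b u)\<bar> \<le> c * exp c * weight n (b u)"
      using weight_pos[of n "b u"] c by (intro abs_diff_le_of_exp_ratio) auto
  qed
  also have "\<dots> = c * exp c"
    using sum_b[of "weight n"] by (simp add: sum_weight flip: sum_distrib_left)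
  \<comment> \<open>Only the exponent is bounded by the diameter; the linear factor \<open>c\<close>
    keeps \<open>\<Omega> (dist x y)\<close>.\<close>
  also have "\<dots> \<le> c * exp (2 * \<kappa> * \<Omega> (1/2))"
    using c \<kappa>_nonneg modulus_mono[OF mod_\<Omega>, of ?D "1/2"] dist_circle_le_half[of x y]
    unfolding c_def by (intro mult_left_mono) (auto intro!: mult_left_mono)
  also have "\<dots> = (2 * \<kappa> * exp (2 * \<kappa> * \<Omega> (1/2))) * \<Omega> ?D" by (simp add: c_def)
  also have "\<dots> \<le> \<Gamma> * \<Omega> ?D"
    using \<Gamma>_ge(1) modulus_nonneg[OF mod_\<Omega>, of ?D] by (intro mult_right_mono) auto
  finally have weight_part: "(\<Sum>u\<in>?P. \<bar>weight n u - weight n (b u)\<bar>) \<le> \<Gamma> * \<Omega> ?D" .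

  have diff_eq: "(transfer V (normalized_potential V f eig h) ^^ n) \<phi> x
      - (transfer V (normalized_potential V f eig h) ^^ n) \<phi> y
      = (\<Sum>u\<in>?P. weight n u * \<phi> u - weight n (b u) * \<phi> (b u))"
    using sum_b[of "\<lambda>v. weight n v * \<phi> v"] by (simp add: normalized_transfer sum_subtractf)
  have "\<bar>\<Sum>u\<in>?P. weight n u * \<phi> u - weight n (b u) * \<phi> (b u)\<bar>
      \<le> (\<Sum>u\<in>?P. m u * (?A * \<Omega> (dist u (b u))) + \<bar>weight n u - weight n (b u)\<bar> * ?S)"
  proof (rule order_trans[OF sum_abs sum_mono])
    fix u
    have "\<bar>weight n u * \<phi> u - weight n (b u) * \<phi> (b u)\<bar>
        \<le> m u * \<bar>\<phi> u - \<phi> (b u)\<bar> + \<bar>weight n u - weight n (b u)\<bar> * ?S"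
      unfolding m_def using weight_pos S by (intro abs_weighted_diff_le) (auto intro: less_imp_le)
    also have "\<dots> \<le> m u * (?A * \<Omega> (dist u (b u))) + \<bar>weight n u - weight n (b u)\<bar> * ?S"
      by (intro add_right_mono mult_left_mono mod_seminorm_bound mod_\<Omega> \<phi> m_nonneg)
    finally show "\<bar>weight n u * \<phi> u - weight n (b u) * \<phi> (b u)\<bar>
        \<le> m u * (?A * \<Omega> (dist u (b u))) + \<bar>weight n u - weight n (b u)\<bar> * ?S" .
  qed
  also have "\<dots> = ?A * (\<Sum>u\<in>?P. m u * \<Omega> (dist u (b u)))
      + ?S * (\<Sum>u\<in>?P. \<bar>weight n u - weight n (b u)\<bar>)"
    by (simp add: sum.distrib sum_distrib_left mult_ac)
  also have "\<dots> \<le> ?A * (\<Gamma> * \<Omega> (\<theta> n * ?D)) + ?S * (\<Gamma> * \<Omega> ?D)"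
    by (intro add_mono mult_left_mono close_part weight_part A S0)
  also have "\<dots> = \<Gamma> * (?A * \<Omega> (\<theta> n * ?D) + ?S * \<Omega> ?D)" by (simp add: algebra_simps)
  finally show ?thesis unfolding diff_eq .
qed

section \<open>From the local to the global estimate\<close>

abbreviation \<tau> :: "nat \<Rightarrow> real" where "\<tau> \<equiv> tau V \<Omega> f eig"

text \<open>Concavity bounds the quotients by \<open>max 1 (\<theta> n)\<close>, so the real
  supremum \<open>\<tau> n\<close> is attached to a bounded set.\<close>

lemma \<Omega>_\<theta>_le_\<tau>:
  assumes "0 \<le> d" "d < 1/2"
  shows "\<Omega> (\<theta> n * d) \<le> \<tau> n * \<Omega> d"
proof (cases "d = 0")
  case False
  have pos: "0 < \<Omega> d" if "0 < d" for d using that mod_\<Omega> by (simp add: modulus_of_continuity_def)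
  have "bdd_above ((\<lambda>d. \<Omega> (\<theta> n * d) / \<Omega> d) ` {0<..<1/2})"
  proof (rule bdd_aboveI2)
    fix d :: real assume d: "d \<in> {0<..<1/2}"
    have "\<Omega> (\<theta> n * d) \<le> \<Omega> (max 1 (\<theta> n) * d)"
      using d \<theta>_nonneg by (intro modulus_mono[OF mod_\<Omega>] mult_right_mono) auto
    also have "\<dots> \<le> max 1 (\<theta> n) * \<Omega> d"
      using d by (intro concave_modulus_le_mult mod_\<Omega> concave) auto
    finally show "\<Omega> (\<theta> n * d) / \<Omega> d \<le> max 1 (\<theta> n)"
      using pos[of d] d by (simp add: pos_divide_le_eq)
  qed
  then have "\<Omega> (\<theta> n * d) / \<Omega> d \<le> \<tau> n"
    unfolding tau_def using assms False by (intro cSUP_upper) auto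
  then show ?thesis using pos[of d] assms False by (simp add: pos_divide_le_eq)
qed (use mod_\<Omega> in \<open>simp add: modulus_of_continuity_def\<close>)

lemma \<tau>_nonneg: "0 \<le> \<tau> n"
proof -
  \<comment> \<open>\<open>1/4\<close> is merely a sample point of the interval over which
    \<open>\<tau>\<close> is taken.\<close>
  have "0 \<le> \<Omega> (\<theta> n * (1/4))" using \<theta>_nonneg by (intro modulus_nonneg[OF mod_\<Omega>]) simp
  also have "\<dots> \<le> \<tau> n * \<Omega> (1/4)" by (rule \<Omega>_\<theta>_le_\<tau>) auto
  finally show ?thesis
    using mod_\<Omega> by (simp add: zero_le_mult_iff modulus_of_continuity_def not_le)
      (metis less_le_not_le zero_less_divide_1_iff zero_less_numeral)
qed

text \<open>The local estimate is summed over \<open>M\<close> short steps from \<open>x\<close> to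
  \<open>y\<close>, each bounded by the same \<open>E\<close>; hence the factor
  \<open>M\<close>.\<close>

lemma normalized_transfer_global_diff_le:
  assumes M: "1 / r < 2 * real M" and \<phi>: "\<phi> \<in> C_mod \<Omega>"
  shows "\<bar>(transfer V (normalized_potential V f eig h) ^^ n) \<phi> x
      - (transfer V (normalized_potential V f eig h) ^^ n) \<phi> y\<bar>
    \<le> (real M * \<Gamma>) * (\<tau> n * mod_seminorm \<Omega> \<phi> + sup_norm \<phi>) * \<Omega> (dist x y)"
proof -
  let ?A = "mod_seminorm \<Omega> \<phi>" and ?S = "sup_norm \<phi>"
  define L where "L = (transfer V (normalized_potential V f eig h) ^^ n) \<phi>"
  define E where "E = \<Gamma> * ((\<tau> n * ?A + ?S) * \<Omega> (dist x y))"
  obtain z where z: "z 0 = x" "z M = y" "\<And>k. dist (z k) (z (Suc k)) \<le> dist x y / real M"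
    using circle_chain[OF chain_step(3)[OF M]] by metis
  have A: "0 \<le> ?A" by (rule mod_seminorm_nonneg[OF mod_\<Omega> \<phi>])
  have S: "0 \<le> ?S" using abs_le_sup_norm[OF mod_\<Omega> \<phi>, of undefined] by linarith
  have \<Gamma>: "0 \<le> \<Gamma>" using \<Gamma>_ge(2) Q_ge_1 by linarith
  have step: "\<bar>L (z k) - L (z (Suc k))\<bar> \<le> E" for k
  proof -
    define d where "d = dist (z k) (z (Suc k))"
    have d: "0 \<le> d" "d < r" "d \<le> dist x y"
      using z(3)[of k] chain_step(1,2)[OF M, of x y] by (auto simp: d_def)
    have \<Omega>d: "\<Omega> d \<le> \<Omega> (dist x y)" by (rule modulus_mono[OF mod_\<Omega> d(1,3)])
    have "\<bar>L (z k) - L (z (Suc k))\<bar> \<le> \<Gamma> * (?A * \<Omega> (\<theta> n * d) + ?S * \<Omega> d)"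
      unfolding L_def d_def by (rule normalized_transfer_diff_le[OF _ \<phi>]) (use d in \<open>simp add: d_def\<close>)
    also have "\<dots> \<le> \<Gamma> * (?A * (\<tau> n * \<Omega> d) + ?S * \<Omega> d)"
      \<comment> \<open>Each step is shorter than \<open>r < 1/2\<close>, inside the range of the
        supremum \<open>\<tau>\<close>, whereas \<open>dist x y\<close> itself may equal
        \<open>1/2\<close>.\<close>
      using d r_less_half by (intro mult_left_mono add_right_mono \<Omega>_\<theta>_le_\<tau> A \<Gamma>) auto
    also have "\<dots> = \<Gamma> * ((\<tau> n * ?A + ?S) * \<Omega> d)" by (simp add: algebra_simps)
    also have "\<dots> \<le> E"
      unfolding E_def using A S \<Gamma> \<tau>_nonneg by (intro mult_left_mono \<Omega>d) auto
    finally show ?thesis .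
  qed
  have "\<bar>L x - L (z k)\<bar> \<le> real k * E" for k
  proof (induction k)
    case (Suc k)
    then show ?case using step[of k] by (simp add: algebra_simps)
  qed (simp add: z)
  from this[of M] show ?thesis by (simp add: z L_def E_def mult_ac)
qed

end

text \<open>Quantifying \<open>K\<close> before all data but \<open>\<rho>\<^sub>1\<close> expresses
  that the multiple depends on \<open>\<rho>\<^sub>1\<close> alone. Membership in
  \<open>C_mod\<close> is part of the claim because only there is the seminorm a meaningful
  supremum.\<close>

theorem proposition7:
  fixes \<rho>\<^sub>1 :: real
  assumes "0 < \<rho>\<^sub>1"
  shows "\<exists>K>0. \<forall>V \<rho>\<^sub>V \<omega> \<Omega> C\<^sub>1 f eig h \<nu>.
    admissible_V V \<longrightarrow> admissible_radius V \<rho>\<^sub>V \<longrightarrow>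
    modulus_of_continuity \<omega> \<longrightarrow> modulus_of_continuity \<Omega> \<longrightarrow>
    T_compatible V \<omega> \<Omega> \<rho>\<^sub>1 C\<^sub>1 \<longrightarrow> \<rho>\<^sub>1 < \<rho>\<^sub>V \<longrightarrow>
    concave_on {0..} \<Omega> \<longrightarrow>
    f \<in> C_mod \<omega> \<longrightarrow> RPF_triple V \<Omega> f eig h \<nu> \<longrightarrow>
      (\<forall>n\<ge>1. \<forall>\<phi>\<in>C_mod \<Omega>. \<forall>x y. dist x y < \<rho>\<^sub>1 \<longrightarrow>
         \<bar>(transfer V (normalized_potential V f eig h) ^^ n) \<phi> x
           - (transfer V (normalized_potential V f eig h) ^^ n) \<phi> y\<bar>
         \<le> Gamma_const \<omega> \<Omega> C\<^sub>1 f h *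
             (mod_seminorm \<Omega> \<phi> * \<Omega> (theta V f eig n * dist x y) + sup_norm \<phi> * \<Omega> (dist x y))) \<and>
      (\<forall>n\<ge>1. \<forall>\<phi>\<in>C_mod \<Omega>.
         (transfer V (normalized_potential V f eig h) ^^ n) \<phi> \<in> C_mod \<Omega> \<and>
         mod_seminorm \<Omega> ((transfer V (normalized_potential V f eig h) ^^ n) \<phi>)
         \<le> (K * Gamma_const \<omega> \<Omega> C\<^sub>1 f h) *
             (tau V \<Omega> f eig n * mod_seminorm \<Omega> \<phi> + sup_norm \<phi>))"
proof -
  \<comment> \<open>\<open>M\<close> counts the steps shorter than \<open>\<rho>\<^sub>1\<close>
    that join any two points; it serves as \<open>K\<close>.\<close>
  obtain M :: nat where "1 / \<rho>\<^sub>1 / 2 < real M" using reals_Archimedean2 by blast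
  then have M: "1 / \<rho>\<^sub>1 < 2 * real M" by simp
  have M_pos: "0 < real M"
    using M assms by (intro of_nat_0_less_iff[THEN iffD2] gr0I) (auto simp: field_simps)
  show ?thesis
  proof (rule exI[of _ "real M"], intro conjI allI impI ballI)
    show "0 < real M" by (fact M_pos)
  next
    fix V \<rho>\<^sub>V \<omega> \<Omega> C\<^sub>1 f eig h \<nu> n \<phi> x y
    assume "admissible_V V" "admissible_radius V \<rho>\<^sub>V" "modulus_of_continuity \<omega>" "modulus_of_continuity \<Omega>"
      "T_compatible V \<omega> \<Omega> \<rho>\<^sub>1 C\<^sub>1" "\<rho>\<^sub>1 < \<rho>\<^sub>V" "concave_on {0..} \<Omega>" "f \<in> C_mod \<omega>"
      "RPF_triple V \<Omega> f eig h \<nu>"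
    then interpret RPF_circle_dynamics V \<rho>\<^sub>V \<omega> \<Omega> \<rho>\<^sub>1 C\<^sub>1 f eig h \<nu> by unfold_locales
    assume \<phi>: "\<phi> \<in> C_mod \<Omega>"
    show "\<bar>(transfer V (normalized_potential V f eig h) ^^ n) \<phi> x
           - (transfer V (normalized_potential V f eig h) ^^ n) \<phi> y\<bar>
         \<le> Gamma_const \<omega> \<Omega> C\<^sub>1 f h *
             (mod_seminorm \<Omega> \<phi> * \<Omega> (theta V f eig n * dist x y) + sup_norm \<phi> * \<Omega> (dist x y))"
      if "dist x y < \<rho>\<^sub>1" using that \<phi> by (rule normalized_transfer_diff_le)
    show "(transfer V (normalized_potential V f eig h) ^^ n) \<phi> \<in> C_mod \<Omega>"
      by (rule C_mod_intro[OF mod_\<Omega> normalized_transfer_global_diff_le[OF M \<phi>]])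
    show "mod_seminorm \<Omega> ((transfer V (normalized_potential V f eig h) ^^ n) \<phi>)
         \<le> (real M * Gamma_const \<omega> \<Omega> C\<^sub>1 f h) *
             (tau V \<Omega> f eig n * mod_seminorm \<Omega> \<phi> + sup_norm \<phi>)"
      by (rule mod_seminorm_le[OF mod_\<Omega> normalized_transfer_global_diff_le[OF M \<phi>]])
  qed
qed

end
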